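(* Let $K$ be an algebraically closed field of characteristic zero, let $P$ be a pure polynomial functor over $K$, and let $p\in P_\infty$ be such that the orbit $\mathrm{GL}_\infty\cdot p$ is dense in $P_\infty$. Then for each integer $n\geq1$, the image of $\mathrm{GL}_\infty\cdot p$ under the projection $P_\infty\to P(K^n)$ is all of $P(K^n)$.
   Context: $\mathbf{Vec}$ is the category of finite-dimensional $K$-vector spaces with $K$-linear maps. A polynomial functor over $K$ is a functor $P\colon\mathbf{Vec}\to\mathbf{Vec}$ for which there is an integer $d$ such that for all $U,V$ the map $P\colon\operatorname{Hom}(U,V)\to\operatorname{Hom}(P(U),P(V))$ is a polynomial map of degree $\leq d$. It is pure if $P(\{0\})=\{0\}$. $P_\infty:=\varprojlim_n P(K^n)$ along the maps $P(\pi_n)\colon P(K^{n+1})\to P(K^n)$, where $\pi_n\colon K^{n+1}\to K^n$ forgets the last coordinate. It carries the inverse limit of the Zariski topologies on the $P(K^n)$. The group $\mathrm{GL}_\infty=\bigcup_n\mathrm{GL}_n$, with $\mathrm{GL}_n\hookrightarrow\mathrm{GL}_{n+1}$ via $g\mapsto\operatorname{diag}(g,1)$, acts on $P_\infty$ (the projections $P(K^{n+1})\to P(K^n)$ being $\mathrm{GL}_n$-equivariant). *)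

theory Defs
  imports
    "Jordan_Normal_Form.VS_Connect"
    "HOL-Analysis.Function_Topology"
begin

text \<open>
  Vector spaces over the field \<open>'k\<close> are records in the sense of \<^theory>\<open>HOL-Algebra.Module\<close>,
  with \<open>class_ring\<close> as the ring of scalars; \<open>module_vec TYPE('k) n\<close> is the space of
  column vectors of length \<open>n\<close>.
\<close>

subsection \<open>The category of finite-dimensional vector spaces\<close>

text \<open>
  The objects are all finite-dimensional vector spaces whose carrier is a set of elements of \<open>'v\<close>.
  For \<open>'v = 'k vec\<close> every finite-dimensional \<open>'k\<close>-vector space is isomorphic to such an object.
\<close>

definition Vec :: "('k::field, 'v) module set" where
  "Vec = {V. vectorspace class_ring V \<and> vectorspace.fin_dim class_ring V}"

text \<open>Morphisms are extensional (\<open>undefined\<close> off the carrier), so that two linear maps are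
  equal as soon as they agree on the carrier.\<close>

definition Hom :: "('k::field, 'u) module \<Rightarrow> ('k, 'v) module \<Rightarrow> ('u \<Rightarrow> 'v) set" where
  "Hom U V = LinearCombinations.module_hom class_ring U V \<inter> extensional (carrier U)"

definition Hom_space :: "('k::field, 'u) module \<Rightarrow> ('k, 'v) module \<Rightarrow> ('k, 'u \<Rightarrow> 'v) module" where
  "Hom_space U V =
    \<lparr>carrier = Hom U V, mult = undefined, one = undefined,
     zero = (\<lambda>x\<in>carrier U. \<zero>\<^bsub>V\<^esub>),
     add = (\<lambda>f g. \<lambda>x\<in>carrier U. f x \<oplus>\<^bsub>V\<^esub> g x),
     smult = (\<lambda>c f. \<lambda>x\<in>carrier U. c \<odot>\<^bsub>V\<^esub> f x)\<rparr>"

subsection \<open>Polynomial maps and the Zariski topology\<close>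

definition scalars :: "('k::field, 'k) module" where
  "scalars = \<lparr>carrier = UNIV, mult = (*), one = 1, zero = 0, add = (+), smult = (*)\<rparr>"

text \<open>
  \<open>poly_fun V d\<close> is the space of polynomial functions of degree at most \<open>d\<close>: the linear span of the
  products of at most \<open>d\<close> linear functionals. Values off the carrier of \<open>V\<close> are irrelevant.
\<close>

inductive poly_fun :: "('k::field, 'v) module \<Rightarrow> nat \<Rightarrow> ('v \<Rightarrow> 'k) \<Rightarrow> bool"
  for V :: "('k, 'v) module" where
  const: "poly_fun V d (\<lambda>_. c)"
| add: "poly_fun V d f \<Longrightarrow> poly_fun V d g \<Longrightarrow> poly_fun V d (\<lambda>x. f x + g x)"
| mult: "l \<in> LinearCombinations.module_hom class_ring V scalars \<Longrightarrow> poly_fun V d f \<Longrightarrow>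
    poly_fun V (Suc d) (\<lambda>x. l x * f x)"

text \<open>A map is polynomial of degree at most \<open>d\<close> if its coordinates with respect to linear
  functionals on the target are.\<close>

definition poly_map ::
  "nat \<Rightarrow> ('k::field, 'u) module \<Rightarrow> ('k, 'v) module \<Rightarrow> ('u \<Rightarrow> 'v) \<Rightarrow> bool" where
  "poly_map d U V F \<longleftrightarrow>
    F \<in> carrier U \<rightarrow> carrier V \<and>
    (\<forall>l \<in> LinearCombinations.module_hom class_ring V scalars.
      \<exists>f. poly_fun U d f \<and> (\<forall>x\<in>carrier U. l (F x) = f x))"

definition zariski_open :: "('k::field, 'v) module \<Rightarrow> 'v set \<Rightarrow> bool" where
  "zariski_open V A \<longleftrightarrow>
    (\<exists>S. (\<forall>f\<in>S. \<exists>d. poly_fun V d f) \<and> A = carrier V - {x \<in> carrier V. \<forall>f\<in>S. f x = 0})"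

definition zariski :: "('k::field, 'v) module \<Rightarrow> 'v topology" where
  "zariski V = topology (zariski_open V)"

lemma poly_fun_cmult: "poly_fun V d f \<Longrightarrow> poly_fun V d (\<lambda>x. c * f x)"
proof (induction rule: poly_fun.induct)
  case (const d a)
  show ?case by (rule poly_fun.const)
next
  case (add d f g)
  then show ?case using poly_fun.add[of V d "\<lambda>x. c * f x" "\<lambda>x. c * g x"]
    by (simp add: distrib_left)
next
  case (mult l d f)
  then show ?case using poly_fun.mult[of l V d "\<lambda>x. c * f x"] by (simp add: mult.left_commute)
qed

lemma poly_fun_mono: "poly_fun V d f \<Longrightarrow> d \<le> e \<Longrightarrow> poly_fun V e f"
proof (induction arbitrary: e rule: poly_fun.induct)
  case (mult l d f)
  then obtain e' where "e = Suc e'" "d \<le> e'" by (auto dest: Suc_le_D)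
  with mult show ?case by (auto intro: poly_fun.mult)
qed (auto intro: poly_fun.const poly_fun.add)

lemma poly_fun_times:
  "poly_fun V d f \<Longrightarrow> poly_fun V e g \<Longrightarrow> poly_fun V (d + e) (\<lambda>x. f x * g x)"
proof (induction rule: poly_fun.induct)
  case (const d c)
  then show ?case using poly_fun_mono[OF poly_fun_cmult[of V e g c]] by simp
next
  case (add d f h)
  then show ?case using poly_fun.add[of V "d + e" "\<lambda>x. f x * g x" "\<lambda>x. h x * g x"]
    by (simp add: distrib_right)
next
  case (mult l d f)
  then show ?case using poly_fun.mult[of l V "d + e" "\<lambda>x. f x * g x"] by (simp add: mult.assoc)
qed

lemma istopology_zariski_open: "istopology (zariski_open V)"
  unfolding istopology_def
proof (intro conjI allI impI)
  fix A B assume "zariski_open V A" "zariski_open V B"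
  then obtain S T where S: "\<forall>f\<in>S. \<exists>d. poly_fun V d f" "A = carrier V - {x \<in> carrier V. \<forall>f\<in>S. f x = 0}"
    and T: "\<forall>f\<in>T. \<exists>d. poly_fun V d f" "B = carrier V - {x \<in> carrier V. \<forall>f\<in>T. f x = 0}"
    unfolding zariski_open_def by blast
  let ?R = "{\<lambda>x. f x * g x |f g. f \<in> S \<and> g \<in> T}"
  have "\<forall>h\<in>?R. \<exists>d. poly_fun V d h" using S(1) T(1) poly_fun_times by blast
  moreover have "A \<inter> B = carrier V - {x \<in> carrier V. \<forall>h\<in>?R. h x = 0}"
    unfolding S(2) T(2) by fastforce
  ultimately show "zariski_open V (A \<inter> B)" unfolding zariski_open_def
    by (intro exI[of _ ?R] conjI)
next
  fix \<K> assume K: "\<forall>A\<in>\<K>. zariski_open V A"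
  let ?R = "{f. (\<exists>d. poly_fun V d f) \<and> (\<forall>x\<in>carrier V. f x \<noteq> 0 \<longrightarrow> x \<in> \<Union>\<K>)}"
  have "\<Union>\<K> \<subseteq> carrier V - {x \<in> carrier V. \<forall>f\<in>?R. f x = 0}"
  proof
    fix x assume "x \<in> \<Union>\<K>"
    then obtain A where A: "A \<in> \<K>" "x \<in> A" by blast
    with K obtain S where S: "\<forall>f\<in>S. \<exists>d. poly_fun V d f"
      "A = carrier V - {x \<in> carrier V. \<forall>f\<in>S. f x = 0}"
      unfolding zariski_open_def by blast
    with A obtain f where f: "f \<in> S" "f x \<noteq> 0" "x \<in> carrier V" by blast
    have "\<forall>y\<in>carrier V. f y \<noteq> 0 \<longrightarrow> y \<in> A" using S(2) f(1) by blast
    then have "f \<in> ?R" using S(1) f(1) A(1) by blast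
    with f show "x \<in> carrier V - {x \<in> carrier V. \<forall>f\<in>?R. f x = 0}" by blast
  qed
  then have "\<Union>\<K> = carrier V - {x \<in> carrier V. \<forall>f\<in>?R. f x = 0}" by blast
  moreover have "\<forall>f\<in>?R. \<exists>d. poly_fun V d f" by blast
  ultimately show "zariski_open V (\<Union>\<K>)" unfolding zariski_open_def
    by (intro exI[of _ ?R] conjI)
qed

lemma openin_zariski: "openin (zariski V) = zariski_open V"
  unfolding zariski_def by (rule topology_inverse'[OF istopology_zariski_open])

lemma topspace_zariski: "topspace (zariski V) = carrier V"
proof -
  have "zariski_open V (carrier V)"
    unfolding zariski_open_def
    by (rule exI[of _ "{\<lambda>_. 1}"]) (auto intro: poly_fun.const)
  moreover have "zariski_open V A \<Longrightarrow> A \<subseteq> carrier V" for A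
    unfolding zariski_open_def by blast
  ultimately show ?thesis unfolding topspace_def openin_zariski by blast
qed

subsection \<open>Polynomial functors\<close>

text \<open>A functor is given by its action \<open>Ob\<close> on objects and its action \<open>Mor U V\<close> on the
  morphisms from \<open>U\<close> to \<open>V\<close>. The type \<open>'w\<close> of the elements of the spaces \<open>Ob V\<close> is arbitrary.\<close>

locale polynomial_functor =
  fixes Ob :: "('k::field, 'k vec) module \<Rightarrow> ('k, 'w) module"
    and Mor :: "('k, 'k vec) module \<Rightarrow> ('k, 'k vec) module \<Rightarrow> ('k vec \<Rightarrow> 'k vec) \<Rightarrow> ('w \<Rightarrow> 'w)"
  assumes Ob_Vec: "V \<in> Vec \<Longrightarrow> Ob V \<in> Vec"
    and Mor_Hom: "U \<in> Vec \<Longrightarrow> V \<in> Vec \<Longrightarrow> f \<in> Hom U V \<Longrightarrow> Mor U V f \<in> Hom (Ob U) (Ob V)"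
    and Mor_id: "V \<in> Vec \<Longrightarrow> Mor V V (\<lambda>x\<in>carrier V. x) = (\<lambda>x\<in>carrier (Ob V). x)"
    and Mor_compose: "U \<in> Vec \<Longrightarrow> V \<in> Vec \<Longrightarrow> W \<in> Vec \<Longrightarrow> f \<in> Hom U V \<Longrightarrow> g \<in> Hom V W \<Longrightarrow>
      Mor U W (compose (carrier U) g f) = compose (carrier (Ob U)) (Mor V W g) (Mor U V f)"
    and bounded_degree:
      "\<exists>d. \<forall>U\<in>Vec. \<forall>V\<in>Vec. poly_map d (Hom_space U V) (Hom_space (Ob U) (Ob V)) (Mor U V)"

locale pure_polynomial_functor = polynomial_functor +
  assumes pure: "V \<in> Vec \<Longrightarrow> carrier V = {\<zero>\<^bsub>V\<^esub>} \<Longrightarrow> carrier (Ob V) = {\<zero>\<^bsub>Ob V\<^esub>}"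

subsection \<open>The inverse limit\<close>

abbreviation K_pow :: "nat \<Rightarrow> ('k::field, 'k vec) module" where
  "K_pow n \<equiv> module_vec TYPE('k) n"

definition K_proj :: "nat \<Rightarrow> nat \<Rightarrow> 'k vec \<Rightarrow> 'k::field vec" where
  "K_proj m n = (\<lambda>v\<in>carrier_vec m. vec_first v n)"

definition P_inf ::
  "(('k::field, 'k vec) module \<Rightarrow> ('k, 'w) module) \<Rightarrow>
   (('k, 'k vec) module \<Rightarrow> ('k, 'k vec) module \<Rightarrow> ('k vec \<Rightarrow> 'k vec) \<Rightarrow> ('w \<Rightarrow> 'w)) \<Rightarrow>
   (nat \<Rightarrow> 'w) set" where
  "P_inf Ob Mor =
    {p. (\<forall>n. p n \<in> carrier (Ob (K_pow n))) \<and>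
        (\<forall>n. Mor (K_pow (Suc n)) (K_pow n) (K_proj (Suc n) n) (p (Suc n)) = p n)}"

definition P_inf_topology ::
  "(('k::field, 'k vec) module \<Rightarrow> ('k, 'w) module) \<Rightarrow>
   (('k, 'k vec) module \<Rightarrow> ('k, 'k vec) module \<Rightarrow> ('k vec \<Rightarrow> 'k vec) \<Rightarrow> ('w \<Rightarrow> 'w)) \<Rightarrow>
   (nat \<Rightarrow> 'w) topology" where
  "P_inf_topology Ob Mor =
    subtopology (product_topology (\<lambda>n. zariski (Ob (K_pow n))) UNIV) (P_inf Ob Mor)"

subsection \<open>The action of the infinite general linear group\<close>

text \<open>
  An element of \<open>GL n\<close> is stored as the infinite matrix obtained by repeatedly bordering an invertible
  matrix of size \<open>n\<close> via \<open>g \<mapsto> diag(g, 1)\<close>. The embeddings thus become inclusions.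
\<close>

definition corner :: "nat \<Rightarrow> (nat \<Rightarrow> nat \<Rightarrow> 'k) \<Rightarrow> 'k mat" where
  "corner n g = mat n n (\<lambda>(i, j). g i j)"

definition GL :: "nat \<Rightarrow> (nat \<Rightarrow> nat \<Rightarrow> 'k::field) set" where
  "GL n = {g. invertible_mat (corner n g) \<and>
              (\<forall>i j. n \<le> i \<or> n \<le> j \<longrightarrow> g i j = (if i = j then 1 else 0))}"

definition GL_inf :: "(nat \<Rightarrow> nat \<Rightarrow> 'k::field) set" where
  "GL_inf = (\<Union>n. GL n)"

definition mat_map :: "nat \<Rightarrow> (nat \<Rightarrow> nat \<Rightarrow> 'k) \<Rightarrow> 'k vec \<Rightarrow> 'k::field vec" where
  "mat_map n g = (\<lambda>v\<in>carrier_vec n. corner n g *\<^sub>v v)"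

text \<open>
  If \<open>g\<close> lies in \<open>GL n\<close>, then the component of \<open>g \<cdot> p\<close> in \<open>P(K\<^sup>m)\<close> is \<open>P(diag(g, 1)) p\<^sub>m\<close>
  for \<open>m \<ge> n\<close>, and the image of \<open>P(g) p\<^sub>n\<close> for \<open>m < n\<close>. The lemmas \<open>gl_act_component\<close> and
  \<open>gl_act_in_P_inf\<close> below show that this is well defined.
\<close>

definition gl_act ::
  "(('k::field, 'k vec) module \<Rightarrow> ('k, 'k vec) module \<Rightarrow> ('k vec \<Rightarrow> 'k vec) \<Rightarrow> ('w \<Rightarrow> 'w)) \<Rightarrow>
   (nat \<Rightarrow> nat \<Rightarrow> 'k) \<Rightarrow> (nat \<Rightarrow> 'w) \<Rightarrow> (nat \<Rightarrow> 'w)" where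
  "gl_act Mor g p = (\<lambda>m. let N = max m (LEAST n. g \<in> GL n) in
     Mor (K_pow N) (K_pow m) (K_proj N m) (Mor (K_pow N) (K_pow N) (mat_map N g) (p N)))"

definition GL_orbit ::
  "(('k::field, 'k vec) module \<Rightarrow> ('k, 'k vec) module \<Rightarrow> ('k vec \<Rightarrow> 'k vec) \<Rightarrow> ('w \<Rightarrow> 'w)) \<Rightarrow>
   (nat \<Rightarrow> 'w) \<Rightarrow> (nat \<Rightarrow> 'w) set" where
  "GL_orbit Mor p = (\<lambda>g. gl_act Mor g p) ` GL_inf"

lemma K_pow_in_Vec: "K_pow n \<in> (Vec :: ('k::field, 'k vec) module set)"
proof -
  interpret vec_space "TYPE('k)" n .
  show ?thesis using vec_vs fin_dim by (auto simp: Vec_def)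
qed

lemma K_proj_Hom: "n \<le> m \<Longrightarrow> K_proj m n \<in> Hom (K_pow m) (K_pow n)"
  by (auto simp: Hom_def LinearCombinations.module_hom_def K_proj_def module_vec_simps vec_first_def)

lemma corner_carrier [simp]: "corner n g \<in> carrier_mat n n"
  by (simp add: corner_def)

lemma mat_map_Hom: "mat_map n g \<in> Hom (K_pow n) (K_pow n)"
  using mult_mat_vec_carrier[OF corner_carrier, of _ n g]
    mult_add_distrib_mat_vec[OF corner_carrier, of _ n _ g] mult_mat_vec[OF corner_carrier, of _ n g]
  by (auto simp: Hom_def LinearCombinations.module_hom_def mat_map_def module_vec_simps)

lemma K_proj_compose:
  "l \<le> m \<Longrightarrow> m \<le> n \<Longrightarrow> compose (carrier_vec n) (K_proj m l) (K_proj n m) = K_proj n l"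
  by (auto simp: K_proj_def compose_def vec_first_def fun_eq_iff)

lemma K_proj_mat_map:
  assumes "g \<in> GL l" "l \<le> m" "m \<le> n"
  shows "compose (carrier_vec n) (K_proj n m) (mat_map n g) =
    compose (carrier_vec n) (mat_map m g) (K_proj n m)"
proof -
  have "vec_first (corner n g *\<^sub>v v) m = corner m g *\<^sub>v vec_first v m" if v: "v \<in> carrier_vec n" for v
  proof (rule eq_vecI)
    fix i assume "i < dim_vec (corner m g *\<^sub>v vec_first v m)"
    then have i: "i < m" by (simp add: corner_def)
    have "(\<Sum>j = 0..<n. g i j * v $ j) = (\<Sum>j = 0..<m. g i j * v $ j)"
      by (rule sum.mono_neutral_right) (use assms i in \<open>auto simp: GL_def\<close>)
    then show "vec_first (corner n g *\<^sub>v v) m $ i = (corner m g *\<^sub>v vec_first v m) $ i"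
      using i assms v by (auto simp: vec_first_def corner_def scalar_prod_def)
  qed (simp add: vec_first_def corner_def)
  then show ?thesis
    using mult_mat_vec_carrier[OF corner_carrier, of _ n g]
    by (auto simp: K_proj_def mat_map_def compose_def fun_eq_iff)
qed

context polynomial_functor
begin

lemma Mor_apply_compose:
  assumes "U \<in> Vec" "V \<in> Vec" "W \<in> Vec" "f \<in> Hom U V" "g \<in> Hom V W" "x \<in> carrier (Ob U)"
  shows "Mor V W g (Mor U V f x) = Mor U W (compose (carrier U) g f) x"
  using Mor_compose[OF assms(1-5)] assms(6) by (simp add: compose_def)

lemma Mor_closed:
  assumes "U \<in> Vec" "V \<in> Vec" "f \<in> Hom U V" "x \<in> carrier (Ob U)"
  shows "Mor U V f x \<in> carrier (Ob V)"
  using Mor_Hom[OF assms(1-3)] assms(4) by (auto simp: Hom_def LinearCombinations.module_hom_def)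

lemma Mor_proj_proj:
  assumes "l \<le> m" "m \<le> n" "x \<in> carrier (Ob (K_pow n))"
  shows "Mor (K_pow m) (K_pow l) (K_proj m l) (Mor (K_pow n) (K_pow m) (K_proj n m) x) =
    Mor (K_pow n) (K_pow l) (K_proj n l) x"
  using assms
  by (simp add: Mor_apply_compose K_pow_in_Vec K_proj_Hom module_vec_simps K_proj_compose)

lemma P_inf_proj:
  assumes p: "p \<in> P_inf Ob Mor" and "m \<le> n"
  shows "Mor (K_pow n) (K_pow m) (K_proj n m) (p n) = p m"
  using assms(2)
proof (induction n rule: dec_induct)
  case base
  have "K_proj m m = (\<lambda>x\<in>carrier (K_pow m :: ('k, 'k vec) module). x)"
    by (auto simp: K_proj_def fun_eq_iff vec_first_def module_vec_simps)
  then have "Mor (K_pow m) (K_pow m) (K_proj m m) = (\<lambda>x\<in>carrier (Ob (K_pow m)). x)"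
    by (simp only: Mor_id[OF K_pow_in_Vec])
  with p show ?case by (simp add: P_inf_def)
next
  case (step n)
  have "p m = Mor (K_pow n) (K_pow m) (K_proj n m)
      (Mor (K_pow (Suc n)) (K_pow n) (K_proj (Suc n) n) (p (Suc n)))"
    using step.IH p by (simp add: P_inf_def)
  also have "\<dots> = Mor (K_pow (Suc n)) (K_pow m) (K_proj (Suc n) m) (p (Suc n))"
    using p step.hyps by (subst Mor_proj_proj) (auto simp: P_inf_def)
  finally show ?case by simp
qed

lemma proj_gl:
  assumes p: "p \<in> P_inf Ob Mor" and g: "g \<in> GL l" and "l \<le> m" "m \<le> n"
  shows "Mor (K_pow n) (K_pow m) (K_proj n m) (Mor (K_pow n) (K_pow n) (mat_map n g) (p n)) =
    Mor (K_pow m) (K_pow m) (mat_map m g) (p m)"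
proof -
  have pn: "p n \<in> carrier (Ob (K_pow n))" using p by (simp add: P_inf_def)
  have "Mor (K_pow n) (K_pow m) (K_proj n m) (Mor (K_pow n) (K_pow n) (mat_map n g) (p n)) =
      Mor (K_pow m) (K_pow m) (mat_map m g) (Mor (K_pow n) (K_pow m) (K_proj n m) (p n))"
    using K_proj_mat_map[OF g \<open>l \<le> m\<close> \<open>m \<le> n\<close>] \<open>m \<le> n\<close> pn
    by (simp add: Mor_apply_compose K_pow_in_Vec K_proj_Hom mat_map_Hom module_vec_simps)
  then show ?thesis using P_inf_proj[OF p \<open>m \<le> n\<close>] by simp
qed

lemma gl_act_eq:
  assumes p: "p \<in> P_inf Ob Mor" and g: "g \<in> GL l" and "l \<le> n" "m \<le> n"
  shows "gl_act Mor g p m =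
    Mor (K_pow n) (K_pow m) (K_proj n m) (Mor (K_pow n) (K_pow n) (mat_map n g) (p n))"
proof -
  define k where "k = (LEAST l. g \<in> GL l)"
  define N where "N = max m k"
  have k: "g \<in> GL k" "k \<le> l" unfolding k_def using g by (auto intro: LeastI Least_le)
  have N: "k \<le> N" "m \<le> N" "N \<le> n" using assms k unfolding N_def by auto
  let ?x = "Mor (K_pow n) (K_pow n) (mat_map n g) (p n)"
  have x: "?x \<in> carrier (Ob (K_pow n))"
    using p by (auto intro!: Mor_closed K_pow_in_Vec mat_map_Hom simp: P_inf_def)
  have "gl_act Mor g p m = Mor (K_pow N) (K_pow m) (K_proj N m)
      (Mor (K_pow N) (K_pow N) (mat_map N g) (p N))"
    by (simp only: gl_act_def Let_def N_def k_def)
  also have "\<dots> = Mor (K_pow N) (K_pow m) (K_proj N m) (Mor (K_pow n) (K_pow N) (K_proj n N) ?x)"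
    using proj_gl[OF p k(1) N(1) N(3)] by simp
  also have "\<dots> = Mor (K_pow n) (K_pow m) (K_proj n m) ?x"
    by (rule Mor_proj_proj[OF N(2,3) x])
  finally show ?thesis .
qed

lemma gl_act_component:
  assumes "p \<in> P_inf Ob Mor" "g \<in> GL n" "n \<le> m"
  shows "gl_act Mor g p m = Mor (K_pow m) (K_pow m) (mat_map m g) (p m)"
  using gl_act_eq[OF assms order_refl] proj_gl[OF assms order_refl] by simp

lemma gl_act_in_P_inf:
  assumes p: "p \<in> P_inf Ob Mor" and "g \<in> GL_inf"
  shows "gl_act Mor g p \<in> P_inf Ob Mor"
proof -
  obtain l where g: "g \<in> GL l" using assms(2) by (auto simp: GL_inf_def)
  have x: "Mor (K_pow n) (K_pow n) (mat_map n g) (p n) \<in> carrier (Ob (K_pow n))" for n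
    using p by (auto intro!: Mor_closed K_pow_in_Vec mat_map_Hom simp: P_inf_def)
  have "gl_act Mor g p m \<in> carrier (Ob (K_pow m))" for m
    using gl_act_eq[OF p g, of "max l m" m] Mor_closed[OF K_pow_in_Vec K_pow_in_Vec K_proj_Hom x]
    by simp
  moreover have "Mor (K_pow (Suc m)) (K_pow m) (K_proj (Suc m) m) (gl_act Mor g p (Suc m)) =
      gl_act Mor g p m" for m
  proof -
    have N: "l \<le> max l (Suc m)" "Suc m \<le> max l (Suc m)" "m \<le> max l (Suc m)" by auto
    show ?thesis
      unfolding gl_act_eq[OF p g N(1,2)] gl_act_eq[OF p g N(1,3)]
      by (rule Mor_proj_proj[OF _ N(2) x]) simp
  qed
  ultimately show ?thesis by (simp add: P_inf_def)
qed

end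

end

(* A surjection B : K^m -> K^n is the projection composed with an element of GL_m, so it suffices to
   find an m, a point x in the image of the orbit in P(K^m), and a surjection B with P(B) x = q.

   Take m = n (b + 1) with b = dim P(K^n) and B_a = (id, a_1 id, ..., a_b id), where a runs through K^b.
   Polarisation (this uses characteristic zero and purity) gives a point p0 of P(K^m) with
   P(B_a) p0 = q + a_1 e_1 + ... + a_b e_b for a basis e_j of P(K^n). In coordinates c of x - p0 the equation
   P(B_a) x = q therefore reads a_i = sum_j c_j f_ij(a) with polynomials f_ij. For c_j = s x_j it has a
   solution in power series in s over the ring of polynomials in the x_j; specialising the ring
   generated by this solution to the algebraically closed field K solves it for all c outside the
   zero set of some nonzero polynomial. The dense orbit meets the complement of that zero set. *)
theory Submission
  imports
    Defs
    "HOL-Computational_Algebra.Polynomial_FPS"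
begin

section \<open>Algebra: generic solvability of systems a_i = sum_j c_j f_ij(a)\<close>

subsection \<open>Polynomial expressions and polynomial functions\<close>

text \<open>Density only provides an orbit point outside a given proper closed subset of P(K^m), so
  solving near one good point is not enough: P(B_a) x = q must be solvable for generic x.
  Polarisation supplies a base point whose image is q plus a vector linear in a. Over c = 0 the
  system thus has the single solution a = 0 with identity Jacobian, whatever degrees occur in P.
  This is what puts the system in fixed-point form and gives a formal solution without an implicit
  function theorem over K. Scaling c by s makes one power series variable enough. A formal solution
  cannot be evaluated at s = t. However, its finitely many entries lie in a domain containing
  K[x][s], and a Chevalley-type argument lifts every homomorphism K[x][s] -> K that avoids one
  nonzero element h to the ring they generate. Such a lift turns the formal solution into a true
  one. There is one parameter a_i for each of the dim P(K^n) equations; the extra block id makes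
  every B_a surjective.\<close>

datatype 'k pexp = PConst 'k | PVar nat | PAdd "'k pexp" "'k pexp" | PMul "'k pexp" "'k pexp"

text \<open>The interpretation \<open>c\<close> of the constants is a parameter because the same
  expression is evaluated over K, with \<open>c\<close> the identity, and over power series, with
  \<open>c\<close> the embedding of K; \<open>hom_on_peval\<close> links the two values.\<close>

primrec peval :: "('k \<Rightarrow> 'r::comm_ring_1) \<Rightarrow> (nat \<Rightarrow> 'r) \<Rightarrow> 'k pexp \<Rightarrow> 'r" where
  "peval c v (PConst a) = c a"
| "peval c v (PVar i) = v i"
| "peval c v (PAdd e f) = peval c v e + peval c v f"
| "peval c v (PMul e f) = peval c v e * peval c v f"

primrec psubst :: "(nat \<Rightarrow> 'k pexp) \<Rightarrow> 'k pexp \<Rightarrow> 'k pexp" where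
  "psubst s (PConst a) = PConst a"
| "psubst s (PVar i) = s i"
| "psubst s (PAdd e f) = PAdd (psubst s e) (psubst s f)"
| "psubst s (PMul e f) = PMul (psubst s e) (psubst s f)"

lemma peval_psubst: "peval c v (psubst s e) = peval c (\<lambda>i. peval c v (s i)) e"
  by (induction e) auto

lemma peval_line:
  fixes a b :: "nat \<Rightarrow> 'k::comm_ring_1"
  shows "\<exists>g. \<forall>t. peval (\<lambda>x. x) (\<lambda>i. a i + t * b i) e = poly g t"
proof (induction e)
  case (PConst c)
  show ?case by (rule exI[of _ "[:c:]"]) simp
next
  case (PVar i)
  show ?case by (rule exI[of _ "[:a i, b i:]"]) simp
next
  case (PAdd e f)
  then obtain g h where "\<forall>t. peval (\<lambda>x. x) (\<lambda>i. a i + t * b i) e = poly g t"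
    "\<forall>t. peval (\<lambda>x. x) (\<lambda>i. a i + t * b i) f = poly h t" by blast
  then show ?case by (intro exI[of _ "g + h"]) simp
next
  case (PMul e f)
  then obtain g h where "\<forall>t. peval (\<lambda>x. x) (\<lambda>i. a i + t * b i) e = poly g t"
    "\<forall>t. peval (\<lambda>x. x) (\<lambda>i. a i + t * b i) f = poly h t" by blast
  then show ?case by (intro exI[of _ "g * h"]) simp
qed

text \<open>The coordinate ring of an infinite-dimensional affine space. As a ring of functions it comes with
  evaluation at every point, and its nonzero elements are nonzero somewhere.\<close>

typedef (overloaded) 'k polyfun = "range (\<lambda>e v. peval (\<lambda>x. x) v e)
    :: ((nat \<Rightarrow> 'k::comm_ring_1) \<Rightarrow> 'k) set"
  by blast

setup_lifting type_definition_polyfun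

lemma range_peval_add: "f \<in> range (\<lambda>e v. peval c v e) \<Longrightarrow> g \<in> range (\<lambda>e v. peval c v e) \<Longrightarrow>
    (\<lambda>v. f v + g v) \<in> range (\<lambda>e v. peval c v e)"
  by (elim imageE) (rule range_eqI[of _ _ "PAdd e e'" for e e'], simp)

lemma range_peval_mult: "f \<in> range (\<lambda>e v. peval c v e) \<Longrightarrow> g \<in> range (\<lambda>e v. peval c v e) \<Longrightarrow>
    (\<lambda>v. f v * g v) \<in> range (\<lambda>e v. peval c v e)"
  by (elim imageE) (rule range_eqI[of _ _ "PMul e e'" for e e'], simp)

lemma range_peval_const: "(\<lambda>v. a) \<in> range (\<lambda>e v. peval (\<lambda>x. x) v e)"
  by (rule range_eqI[of _ _ "PConst a"]) simp

instantiation polyfun :: (comm_ring_1) comm_ring_1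
begin

lift_definition zero_polyfun :: "'a polyfun" is "\<lambda>_. 0"
  by (rule range_peval_const)

lift_definition one_polyfun :: "'a polyfun" is "\<lambda>_. 1"
  by (rule range_peval_const)

lift_definition plus_polyfun :: "'a polyfun \<Rightarrow> 'a polyfun \<Rightarrow> 'a polyfun" is "\<lambda>f g v. f v + g v"
  by (rule range_peval_add)

lift_definition times_polyfun :: "'a polyfun \<Rightarrow> 'a polyfun \<Rightarrow> 'a polyfun" is "\<lambda>f g v. f v * g v"
  by (rule range_peval_mult)

lift_definition uminus_polyfun :: "'a polyfun \<Rightarrow> 'a polyfun" is "\<lambda>f v. - 1 * f v"
  by (rule range_peval_mult[OF range_peval_const])

lift_definition minus_polyfun :: "'a polyfun \<Rightarrow> 'a polyfun \<Rightarrow> 'a polyfun" is "\<lambda>f g v. f v + - 1 * g v"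
  by (rule range_peval_add[OF _ range_peval_mult[OF range_peval_const]])

instance
  by standard (transfer; simp add: algebra_simps fun_eq_iff)+

end

text \<open>Pick points where the two factors are nonzero. On the line joining them each factor is a
  nonzero polynomial in one parameter, and the product of these has a nonroot since K is
  infinite.\<close>

instance polyfun :: (field_char_0) idom
proof
  fix f g :: "'a polyfun"
  assume "f \<noteq> 0" "g \<noteq> 0"
  then show "f * g \<noteq> 0"
  proof (transfer)
    fix f g :: "(nat \<Rightarrow> 'a) \<Rightarrow> 'a"
    assume "f \<in> range (\<lambda>e v. peval (\<lambda>x. x) v e)" "g \<in> range (\<lambda>e v. peval (\<lambda>x. x) v e)"
    then obtain e e' where f: "f = (\<lambda>v. peval (\<lambda>x. x) v e)" and g: "g = (\<lambda>v. peval (\<lambda>x. x) v e')" by blast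
    assume "f \<noteq> (\<lambda>_. 0)" "g \<noteq> (\<lambda>_. 0)"
    then obtain a b where ab: "f a \<noteq> 0" "g b \<noteq> 0" by (auto simp: fun_eq_iff)
    define l where "l = (\<lambda>t i. a i + t * (b i - a i))"
    obtain p where p: "\<forall>t. f (l t) = poly p t"
      using peval_line[of a "\<lambda>i. b i - a i" e] f unfolding l_def by blast
    obtain q where q: "\<forall>t. g (l t) = poly q t"
      using peval_line[of a "\<lambda>i. b i - a i" e'] g unfolding l_def by blast
    have "l 0 = a" "l 1 = b" by (simp_all add: l_def)
    then have "poly p 0 \<noteq> 0" "poly q 1 \<noteq> 0" using ab p q by metis+
    then have "p * q \<noteq> 0" by auto
    then obtain t where "poly (p * q) t \<noteq> 0" using poly_all_0_iff_0 by blast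
    then have "f (l t) * g (l t) \<noteq> 0" using p q by simp
    then show "(\<lambda>v. f v * g v) \<noteq> (\<lambda>_. 0)" by metis
  qed
qed

lift_definition polyfun_const :: "'k::comm_ring_1 \<Rightarrow> 'k polyfun" is "\<lambda>c _. c"
  by (rule range_eqI[of _ _ "PConst _"]) simp

lift_definition polyfun_var :: "nat \<Rightarrow> 'k::comm_ring_1 polyfun" is "\<lambda>i v. v i"
  by (rule range_eqI[of _ _ "PVar _"]) simp

lift_definition polyfun_at :: "(nat \<Rightarrow> 'k) \<Rightarrow> 'k::comm_ring_1 polyfun \<Rightarrow> 'k" is "\<lambda>v f. f v" .

lemma polyfun_at_simps [simp]:
  "polyfun_at v (f + g) = polyfun_at v f + polyfun_at v g"
  "polyfun_at v (f * g) = polyfun_at v f * polyfun_at v g"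
  "polyfun_at v 1 = 1" "polyfun_at v 0 = 0"
  "polyfun_at v (polyfun_const c) = c"
  "polyfun_at v (polyfun_var i) = v i"
  by (transfer; simp)+

lemma polyfun_peval: "\<exists>e. \<forall>v. polyfun_at v f = peval (\<lambda>x. x) v e"
  by transfer auto

lemma polyfun_nonzero: "f \<noteq> 0 \<Longrightarrow> \<exists>v. polyfun_at v f \<noteq> 0"
  by transfer (auto simp: fun_eq_iff)

subsection \<open>Extension of specialisations\<close>

text \<open>Subrings are sets inside one ambient ring, and a homomorphism on one
  (\<open>hom_on\<close>) is a total function constrained only there; adjoining an element thus
  changes no type.\<close>

definition is_subring :: "'r::comm_ring_1 set \<Rightarrow> bool" where
  "is_subring A \<longleftrightarrow> 1 \<in> A \<and> (\<forall>x\<in>A. - x \<in> A) \<and> (\<forall>x\<in>A. \<forall>y\<in>A. x + y \<in> A \<and> x * y \<in> A)"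

definition hom_on :: "'r::comm_ring_1 set \<Rightarrow> ('r \<Rightarrow> 's::comm_ring_1) \<Rightarrow> bool" where
  "hom_on A \<phi> \<longleftrightarrow> \<phi> 1 = 1 \<and> (\<forall>x\<in>A. \<forall>y\<in>A. \<phi> (x + y) = \<phi> x + \<phi> y \<and> \<phi> (x * y) = \<phi> x * \<phi> y)"

definition poly_over :: "'r::comm_ring_1 set \<Rightarrow> 'r poly \<Rightarrow> bool" where
  "poly_over A f \<longleftrightarrow> (\<forall>i. coeff f i \<in> A)"

definition adjoin :: "'r::comm_ring_1 set \<Rightarrow> 'r \<Rightarrow> 'r set" where
  "adjoin A y = {poly f y | f. poly_over A f}"

lemma is_subringD:
  assumes "is_subring A"
  shows "1 \<in> A" "0 \<in> A" "x \<in> A \<Longrightarrow> - x \<in> A" "x \<in> A \<Longrightarrow> y \<in> A \<Longrightarrow> x + y \<in> A"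
    "x \<in> A \<Longrightarrow> y \<in> A \<Longrightarrow> x * y \<in> A" "x \<in> A \<Longrightarrow> y \<in> A \<Longrightarrow> x - y \<in> A"
proof -
  show *: "1 \<in> A" "x \<in> A \<Longrightarrow> - x \<in> A" "x \<in> A \<Longrightarrow> y \<in> A \<Longrightarrow> x + y \<in> A"
    "x \<in> A \<Longrightarrow> y \<in> A \<Longrightarrow> x * y \<in> A" for x y using assms unfolding is_subring_def by auto
  have "1 + - 1 \<in> A" using assms unfolding is_subring_def by blast
  then show "0 \<in> A" by simp
  show "x \<in> A \<Longrightarrow> y \<in> A \<Longrightarrow> x - y \<in> A" using *(3)[of x "- y"] *(2)[of y] by simp
qed

lemma subring_sum: "is_subring A \<Longrightarrow> (\<And>i. i \<in> I \<Longrightarrow> f i \<in> A) \<Longrightarrow> sum f I \<in> A"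
  by (induction I rule: infinite_finite_induct) (auto intro: is_subringD)

lemma subring_power: "is_subring A \<Longrightarrow> x \<in> A \<Longrightarrow> x ^ k \<in> A"
  by (induction k) (auto intro: is_subringD)

lemma hom_onD:
  assumes "hom_on A \<phi>"
  shows "\<phi> 1 = 1" "x \<in> A \<Longrightarrow> y \<in> A \<Longrightarrow> \<phi> (x + y) = \<phi> x + \<phi> y"
    "x \<in> A \<Longrightarrow> y \<in> A \<Longrightarrow> \<phi> (x * y) = \<phi> x * \<phi> y"
  using assms unfolding hom_on_def by auto

lemma hom_on_0:
  assumes "is_subring A" "hom_on A \<phi>"
  shows "\<phi> 0 = 0"
  using hom_onD(2)[OF assms(2), of 0 0] is_subringD(2)[OF assms(1)] by simp

lemma hom_on_sum:
  "is_subring A \<Longrightarrow> hom_on A \<phi> \<Longrightarrow> (\<And>i. i \<in> I \<Longrightarrow> f i \<in> A) \<Longrightarrow> \<phi> (sum f I) = (\<Sum>i\<in>I. \<phi> (f i))"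
  by (induction I rule: infinite_finite_induct) (auto simp: hom_on_0 hom_onD(2) subring_sum)

lemma hom_on_power: "is_subring A \<Longrightarrow> hom_on A \<phi> \<Longrightarrow> x \<in> A \<Longrightarrow> \<phi> (x ^ k) = \<phi> x ^ k"
  by (induction k) (auto simp: hom_onD subring_power)

context
  fixes A :: "'r::comm_ring_1 set"
  assumes A: "is_subring A"
begin

lemma poly_over_add: "poly_over A f \<Longrightarrow> poly_over A g \<Longrightarrow> poly_over A (f + g)"
  by (auto simp: poly_over_def intro: is_subringD[OF A])

lemma poly_over_diff: "poly_over A f \<Longrightarrow> poly_over A g \<Longrightarrow> poly_over A (f - g)"
  by (auto simp: poly_over_def intro: is_subringD[OF A])

lemma poly_over_mult: "poly_over A f \<Longrightarrow> poly_over A g \<Longrightarrow> poly_over A (f * g)"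
  unfolding poly_over_def coeff_mult
  by (intro allI subring_sum[OF A] is_subringD(5)[OF A]) auto

lemma poly_over_smult: "c \<in> A \<Longrightarrow> poly_over A f \<Longrightarrow> poly_over A (smult c f)"
  by (auto simp: poly_over_def intro: is_subringD[OF A])

lemma poly_over_monom: "c \<in> A \<Longrightarrow> poly_over A (monom c k)"
  by (auto simp: poly_over_def is_subringD(2)[OF A])

lemma poly_over_pCons: "c \<in> A \<Longrightarrow> poly_over A f \<Longrightarrow> poly_over A (pCons c f)"
  by (auto simp: poly_over_def coeff_pCons split: nat.split)

lemma poly_over_0: "poly_over A 0"
  by (auto simp: poly_over_def is_subringD(2)[OF A])

lemma poly_over_const: "c \<in> A \<Longrightarrow> poly_over A [:c:]"
  by (intro poly_over_pCons poly_over_0)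

lemma poly_over_uminus: "poly_over A f \<Longrightarrow> poly_over A (- f)"
  by (auto simp: poly_over_def intro: is_subringD[OF A])

lemma adjoinI: "poly_over A f \<Longrightarrow> poly f y \<in> adjoin A y"
  unfolding adjoin_def by blast

lemma is_subring_adjoin: "is_subring (adjoin A y)"
  unfolding is_subring_def
proof (intro conjI ballI)
  show "1 \<in> adjoin A y"
    using adjoinI[OF poly_over_const[OF is_subringD(1)[OF A]], of y] by simp
next
  fix x assume "x \<in> adjoin A y"
  then obtain f where "poly_over A f" "x = poly f y" unfolding adjoin_def by blast
  then show "- x \<in> adjoin A y" using adjoinI[OF poly_over_uminus, of f y] by simp
next
  fix x z assume "x \<in> adjoin A y" "z \<in> adjoin A y"
  then obtain f g where "poly_over A f" "x = poly f y" "poly_over A g" "z = poly g y"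
    unfolding adjoin_def by blast
  then show "x + z \<in> adjoin A y" "x * z \<in> adjoin A y"
    using adjoinI[OF poly_over_add, of f g y] adjoinI[OF poly_over_mult, of f g y] by simp_all
qed

lemma adjoin_base: "A \<subseteq> adjoin A y"
  using adjoinI[OF poly_over_const] by fastforce

lemma adjoin_generator: "y \<in> adjoin A y"
  using adjoinI[OF poly_over_pCons[OF _ poly_over_const, OF is_subringD(2)[OF A] is_subringD(1)[OF A]], of y]
  by simp

context
  fixes \<phi> :: "'r \<Rightarrow> 's::comm_ring_1"
  assumes \<phi>: "hom_on A \<phi>"
begin

lemma coeff_map_hom: "coeff (map_poly \<phi> f) i = \<phi> (coeff f i)"
  by (simp add: coeff_map_poly hom_on_0[OF A \<phi>])

lemma map_hom_add: "poly_over A f \<Longrightarrow> poly_over A g \<Longrightarrow>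
    map_poly \<phi> (f + g) = map_poly \<phi> f + map_poly \<phi> g"
  by (rule poly_eqI) (simp add: coeff_map_hom hom_onD(2)[OF \<phi>] poly_over_def)

lemma map_hom_mult: "poly_over A f \<Longrightarrow> poly_over A g \<Longrightarrow>
    map_poly \<phi> (f * g) = map_poly \<phi> f * map_poly \<phi> g"
  by (rule poly_eqI)
    (simp add: coeff_map_hom coeff_mult hom_on_sum[OF A \<phi>] hom_onD(3)[OF \<phi>] is_subringD(5)[OF A] poly_over_def)

lemma map_hom_smult: "c \<in> A \<Longrightarrow> poly_over A f \<Longrightarrow>
    map_poly \<phi> (smult c f) = smult (\<phi> c) (map_poly \<phi> f)"
  by (rule poly_eqI) (simp add: coeff_map_hom hom_onD(3)[OF \<phi>] poly_over_def)

lemma map_hom_diff: "poly_over A f \<Longrightarrow> poly_over A g \<Longrightarrow>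
    map_poly \<phi> (f - g) = map_poly \<phi> f - map_poly \<phi> g"
  using map_hom_add[of "f - g" g] poly_over_diff by (simp add: algebra_simps)

lemma map_hom_const: "map_poly \<phi> [:c:] = [:\<phi> c:]"
  by (rule poly_eqI) (simp add: coeff_map_hom coeff_pCons hom_on_0[OF A \<phi>] split: nat.split)

text \<open>The extension sends y to d. Two polynomials representing the same element of
  \<open>adjoin A y\<close> differ by one that vanishes at y, so \<open>rel\<close> is exactly the
  well-definedness of this rule.\<close>

lemma hom_extend:
  assumes rel: "\<And>f. poly_over A f \<Longrightarrow> poly f y = 0 \<Longrightarrow> poly (map_poly \<phi> f) d = 0"
  shows "\<exists>\<psi>. hom_on (adjoin A y) \<psi> \<and> (\<forall>x\<in>A. \<psi> x = \<phi> x) \<and>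
    (\<forall>f. poly_over A f \<longrightarrow> \<psi> (poly f y) = poly (map_poly \<phi> f) d)"
proof -
  define \<psi> where "\<psi> x = poly (map_poly \<phi> (SOME f. poly_over A f \<and> poly f y = x)) d" for x
  have \<psi>: "\<psi> (poly f y) = poly (map_poly \<phi> f) d" if f: "poly_over A f" for f
  proof -
    define g where "g = (SOME g. poly_over A g \<and> poly g y = poly f y)"
    have g: "poly_over A g \<and> poly g y = poly f y"
      unfolding g_def by (rule someI[of _ f]) (simp add: f)
    then have "poly (map_poly \<phi> (g - f)) d = 0" using f by (intro rel poly_over_diff) auto
    then show ?thesis using f g unfolding \<psi>_def g_def[symmetric] by (simp add: map_hom_diff)
  qed
  have base: "\<psi> x = \<phi> x" if "x \<in> A" for x
    using \<psi>[OF poly_over_const[OF that]] by (simp add: map_hom_const)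
  have "hom_on (adjoin A y) \<psi>" unfolding hom_on_def
  proof (intro conjI ballI)
    show "\<psi> 1 = 1" using base is_subringD(1)[OF A] hom_onD(1)[OF \<phi>] by simp
    fix x z assume "x \<in> adjoin A y" "z \<in> adjoin A y"
    then obtain f g where fg: "x = poly f y" "z = poly g y" "poly_over A f" "poly_over A g"
      unfolding adjoin_def by blast
    show "\<psi> (x + z) = \<psi> x + \<psi> z"
      using \<psi>[OF poly_over_add[OF fg(3,4)]] fg \<psi> by (simp add: map_hom_add)
    show "\<psi> (x * z) = \<psi> x * \<psi> z"
      using \<psi>[OF poly_over_mult[OF fg(3,4)]] fg \<psi> by (simp add: map_hom_mult)
  qed
  with base \<psi> show ?thesis by blast
qed

end
end

text \<open>Long division in which each step multiplies by the leading coefficient of g in place of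
  dividing by it, so that the coefficients never leave A.\<close>

lemma pseudo_division_over:
  fixes A :: "'r::idom set"
  assumes A: "is_subring A" and g: "poly_over A g" "g \<noteq> 0"
  shows "poly_over A f \<Longrightarrow> \<exists>k q r. poly_over A q \<and> poly_over A r \<and>
    smult (lead_coeff g ^ k) f = g * q + r \<and> (r = 0 \<or> degree r < degree g)"
proof (induction "degree f" arbitrary: f rule: less_induct)
  case less
  let ?c = "lead_coeff g"
  have c: "?c \<in> A" using g by (auto simp: poly_over_def)
  consider "degree f < degree g" | "degree g = 0" | "degree g \<le> degree f" "degree g > 0" by linarith
  then show ?case
  proof cases
    case 1
    then show ?thesis
      by (intro exI[of _ 0] exI[of _ f]) (simp add: poly_over_0[OF A] less.prems)
  next
    \<comment> \<open>For constant g the degree of f cannot be forced to drop; a single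
      multiplication by g already gives remainder 0.\<close>
    case 2
    then obtain a where a: "g = [:a:]" by (meson degree_eq_zeroE)
    show ?thesis
      by (rule exI[of _ 1], rule exI[of _ f], rule exI[of _ 0])
        (use a less.prems poly_over_0[OF A] in simp)
  next
    case 3
    define m where "m = monom (lead_coeff f) (degree f - degree g)"
    have m: "poly_over A m" unfolding m_def
      using less.prems by (intro poly_over_monom[OF A]) (auto simp: poly_over_def)
    define f' where "f' = smult ?c f - g * m"
    have f': "poly_over A f'" unfolding f'_def
      by (intro poly_over_diff[OF A] poly_over_smult[OF A] poly_over_mult[OF A] c less.prems g m)
    have "f \<noteq> 0" using 3 by auto
    have "m \<noteq> 0" using \<open>f \<noteq> 0\<close> unfolding m_def by simp
    have dm: "degree m = degree f - degree g" unfolding m_def using \<open>f \<noteq> 0\<close> by (simp add: degree_monom_eq)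
    have "degree (g * m) = degree f"
      using 3 \<open>m \<noteq> 0\<close> g dm by (simp add: degree_mult_eq)
    then have "degree f' \<le> degree f" unfolding f'_def
      by (intro degree_diff_le) auto
    moreover have "coeff f' (degree f) = 0"
    proof -
      have "coeff (g * m) (degree f) = ?c * lead_coeff m"
        using 3 dm coeff_mult_degree_sum[of g m] by simp
      also have "lead_coeff m = lead_coeff f" using dm by (simp add: m_def)
      finally show ?thesis unfolding f'_def by simp
    qed
    ultimately have "degree f' < degree f" using 3
      by (metis coeff_0_degree_minus_1 degree_0 leading_coeff_0_iff le_neq_implies_less less_le_trans)
    from less.hyps[OF this f'] obtain k q r where kqr: "poly_over A q" "poly_over A r"
      "smult (?c ^ k) f' = g * q + r" "r = 0 \<or> degree r < degree g" by blast
    have "smult (?c ^ Suc k) f = smult (?c ^ k) f' + g * smult (?c ^ k) m"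
      unfolding f'_def by (simp add: smult_diff_right mult.commute)
    also have "\<dots> = g * (q + smult (?c ^ k) m) + r" using kqr(3) by (simp add: algebra_simps)
    finally show ?thesis
      using kqr m subring_power[OF A c]
      by (intro exI[of _ "Suc k"] exI[of _ "q + smult (?c ^ k) m"] exI[of _ r])
        (auto intro!: poly_over_add[OF A] poly_over_smult[OF A])
  qed
qed

text \<open>The nonvanishing of u is kept in the conclusion so that the property composes: the
  element h demanded by the upper extension serves as the u of the lower one. The
  \<open>itself\<close> argument names the target of the homomorphisms.\<close>

definition homs_extend :: "'k::comm_ring_1 itself \<Rightarrow> 'r::comm_ring_1 set \<Rightarrow> 'r set \<Rightarrow> 'r \<Rightarrow> bool" where
  "homs_extend _ A B u \<longleftrightarrow> (\<exists>h\<in>A. h \<noteq> 0 \<and> (\<forall>\<phi> :: 'r \<Rightarrow> 'k. hom_on A \<phi> \<longrightarrow> \<phi> h \<noteq> 0 \<longrightarrow>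
    (\<exists>\<psi>. hom_on B \<psi> \<and> (\<forall>x\<in>A. \<psi> x = \<phi> x) \<and> \<psi> u \<noteq> 0)))"

lemma homs_extend_trans:
  assumes "A \<subseteq> B" "homs_extend TYPE('k::comm_ring_1) B C u" "\<And>v. v \<in> B \<Longrightarrow> v \<noteq> 0 \<Longrightarrow> homs_extend TYPE('k) A B v"
  shows "homs_extend TYPE('k) A C (u :: 'r::comm_ring_1)"
proof -
  obtain h' where h': "h' \<in> B" "h' \<noteq> 0" and C: "\<And>\<phi> :: 'r \<Rightarrow> 'k. hom_on B \<phi> \<Longrightarrow> \<phi> h' \<noteq> 0 \<Longrightarrow>
    \<exists>\<psi>. hom_on C \<psi> \<and> (\<forall>x\<in>B. \<psi> x = \<phi> x) \<and> \<psi> u \<noteq> 0"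
    using assms(2) unfolding homs_extend_def by metis
  obtain h where h: "h \<in> A" "h \<noteq> 0" and B: "\<And>\<phi> :: 'r \<Rightarrow> 'k. hom_on A \<phi> \<Longrightarrow> \<phi> h \<noteq> 0 \<Longrightarrow>
    \<exists>\<psi>. hom_on B \<psi> \<and> (\<forall>x\<in>A. \<psi> x = \<phi> x) \<and> \<psi> h' \<noteq> 0"
    using assms(3)[OF h'] unfolding homs_extend_def by metis
  show ?thesis
    unfolding homs_extend_def
  proof (intro bexI[of _ h] conjI allI impI h)
    fix \<phi> :: "'r \<Rightarrow> 'k" assume "hom_on A \<phi>" "\<phi> h \<noteq> 0"
    from B[OF this] obtain \<psi> where \<psi>: "hom_on B \<psi>" "\<forall>x\<in>A. \<psi> x = \<phi> x" "\<psi> h' \<noteq> 0" by blast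
    from C[OF this(1,3)] obtain \<psi>' where "hom_on C \<psi>'" "\<forall>x\<in>B. \<psi>' x = \<psi> x" "\<psi>' u \<noteq> 0" by blast
    with \<psi> assms(1) show "\<exists>\<psi>. hom_on C \<psi> \<and> (\<forall>x\<in>A. \<psi> x = \<phi> x) \<and> \<psi> u \<noteq> 0"
      by (intro exI[of _ \<psi>']) auto
  qed
qed

text \<open>If y satisfies no equation over A, it may be sent anywhere, and h only has to keep the
  polynomial representing u nonzero. Otherwise y must go to a root of the image of an equation f of
  least degree; algebraic closedness provides a root once the leading coefficient of f
  survives.\<close>

lemma adjoin_step:
  fixes A :: "'r::idom set"
  assumes A: "is_subring A" and u: "u \<in> adjoin A y" "u \<noteq> 0"
  shows "homs_extend TYPE('k::{alg_closed_field, field_char_0}) A (adjoin A y) u"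
proof -
  obtain v where v: "poly_over A v" "u = poly v y" using u unfolding adjoin_def by blast
  define rel where "rel f \<longleftrightarrow> poly_over A f \<and> f \<noteq> 0 \<and> poly f y = 0" for f
  show ?thesis
  proof (cases "\<exists>f. rel f")
    case False
    have "v \<noteq> 0" using v u by auto
    show ?thesis
      unfolding homs_extend_def
    proof (intro bexI[of _ "lead_coeff v"] conjI allI impI)
      show "lead_coeff v \<in> A" using v by (simp add: poly_over_def)
      show "lead_coeff v \<noteq> 0" using \<open>v \<noteq> 0\<close> by simp
      fix \<phi> :: "'r \<Rightarrow> 'k" assume \<phi>: "hom_on A \<phi>" "\<phi> (lead_coeff v) \<noteq> 0"
      then have "map_poly \<phi> v \<noteq> 0" using coeff_map_hom[OF A \<phi>(1), of v "degree v"] by auto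
      then obtain d where d: "poly (map_poly \<phi> v) d \<noteq> 0" using poly_all_0_iff_0 by blast
      have "poly (map_poly \<phi> f) d = 0" if "poly_over A f" "poly f y = 0" for f
        using False that unfolding rel_def by auto
      from hom_extend[OF A \<phi>(1) this] show "\<exists>\<psi>. hom_on (adjoin A y) \<psi> \<and> (\<forall>x\<in>A. \<psi> x = \<phi> x) \<and> \<psi> u \<noteq> 0"
        using v d by metis
    qed
  next
    case True
    then obtain f where "rel f" and min: "\<And>g. rel g \<Longrightarrow> degree f \<le> degree g"
      using ex_has_least_nat[of rel _ degree] by metis
    then have f: "poly_over A f" "f \<noteq> 0" "poly f y = 0" unfolding rel_def by auto
    have small: "r = 0" if "poly_over A r" "poly r y = 0" "r = 0 \<or> degree r < degree f" for r
      using min[of r] that unfolding rel_def by (metis not_le)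
    have "degree f > 0"
    proof (rule ccontr)
      assume "\<not> 0 < degree f"
      then obtain a where "f = [:a:]" by (meson degree_eq_zeroE gr0I)
      with f show False by simp
    qed
    \<comment> \<open>A polynomial \<open>w\<close> of least degree whose value is a nonzero multiple of \<open>u\<close> pseudo-divides the minimal
      polynomial \<open>f\<close>, hence is a constant \<open>g0\<close>; so \<open>u\<close> survives wherever \<open>g0\<close> does.\<close>
    define mult where "mult w \<longleftrightarrow> poly_over A w \<and> poly w y \<noteq> 0 \<and> (\<exists>z. poly_over A z \<and> poly w y = u * poly z y)" for w
    have "mult v" unfolding mult_def using u v poly_over_const[OF A is_subringD(1)[OF A]]
      by (auto intro!: exI[of _ "[:1:]"])
    then obtain w where "mult w" and wmin: "\<And>g. mult g \<Longrightarrow> degree w \<le> degree g"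
      using ex_has_least_nat[of mult _ degree] by metis
    then obtain z where w: "poly_over A w" "poly w y \<noteq> 0" and z: "poly_over A z" "poly w y = u * poly z y"
      unfolding mult_def by blast
    have "degree w < degree f"
    proof -
      obtain k q r where kqr: "poly_over A q" "poly_over A r"
        "smult (lead_coeff f ^ k) v = f * q + r" "r = 0 \<or> degree r < degree f"
        using pseudo_division_over[OF A f(1,2) v(1)] by blast
      have lf: "lead_coeff f ^ k \<in> A" using f by (auto intro!: subring_power[OF A] simp: poly_over_def)
      have "poly r y = lead_coeff f ^ k * u"
        using arg_cong[OF kqr(3), of "\<lambda>p. poly p y"] f v by simp
      then have "mult r" unfolding mult_def using kqr f u poly_over_const[OF A lf]
        by (auto intro!: exI[of _ "[:lead_coeff f ^ k:]"])
      moreover from this have "r \<noteq> 0" unfolding mult_def by auto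
      ultimately show ?thesis using wmin[of r] kqr(4) by auto
    qed
    have "degree w = 0"
    proof -
      have "w \<noteq> 0" using w by auto
      obtain k q r where kqr: "poly_over A q" "poly_over A r"
        "smult (lead_coeff w ^ k) f = w * q + r" "r = 0 \<or> degree r < degree w"
        using pseudo_division_over[OF A w(1) \<open>w \<noteq> 0\<close> f(1)] by blast
      have r: "poly r y = - (poly w y * poly q y)"
        using arg_cong[OF kqr(3), of "\<lambda>p. poly p y"] f by (simp add: eq_neg_iff_add_eq_0 add.commute)
      have "poly r y = 0"
      proof (rule ccontr)
        assume ne: "poly r y \<noteq> 0"
        have "poly r y = u * poly (- (z * q)) y" using r z by simp
        then have "mult r" unfolding mult_def
          using ne kqr(2) poly_over_uminus[OF A poly_over_mult[OF A z(1) kqr(1)]] by blast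
        then show False using wmin[of r] kqr(4) ne by auto
      qed
      then have "r = 0" using small kqr \<open>degree w < degree f\<close> by auto
      then have wq: "smult (lead_coeff w ^ k) f = w * q" using kqr by simp
      \<comment> \<open>The ambient ring is a domain and w does not vanish at y, so the root y
        passes to q; minimality of f then leaves degree 0 for w.\<close>
      have "poly q y = 0" using r w \<open>poly r y = 0\<close> by simp
      have "q \<noteq> 0" using wq f \<open>w \<noteq> 0\<close> by auto
      then have "degree f \<le> degree q" using min kqr \<open>poly q y = 0\<close> unfolding rel_def by blast
      moreover have "degree f = degree w + degree q"
        using arg_cong[OF wq, of degree] \<open>w \<noteq> 0\<close> \<open>q \<noteq> 0\<close> by (simp add: degree_mult_eq)
      ultimately show ?thesis by simp
    qed
    then obtain g0 where g0: "w = [:g0:]" by (meson degree_eq_zeroE)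
    have g0A: "g0 \<in> A" using w g0 unfolding poly_over_def by (metis coeff_pCons_0)
    have lf: "lead_coeff f \<in> A" using f by (simp add: poly_over_def)
    show ?thesis
      unfolding homs_extend_def
    \<comment> \<open>The first factor keeps the image of f nonconstant and can be cancelled after
      pseudo-division by f; the second keeps u nonzero.\<close>
    proof (intro bexI[of _ "lead_coeff f * g0"] conjI allI impI)
      show "lead_coeff f * g0 \<in> A" by (intro is_subringD(5)[OF A] g0A lf)
      show "lead_coeff f * g0 \<noteq> 0" using f g0 w by auto
      fix \<phi> :: "'r \<Rightarrow> 'k" assume \<phi>: "hom_on A \<phi>" "\<phi> (lead_coeff f * g0) \<noteq> 0"
      then have ne: "\<phi> (lead_coeff f) \<noteq> 0" "\<phi> g0 \<noteq> 0" using hom_onD(3)[OF \<phi>(1) lf g0A] by auto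
      have "degree (map_poly \<phi> f) > 0"
        using ne coeff_map_hom[OF A \<phi>(1), of f "degree f"] \<open>degree f > 0\<close> le_degree[of "map_poly \<phi> f" "degree f"]
        by auto
      then obtain d where d: "poly (map_poly \<phi> f) d = 0"
        using alg_closed_imp_poly_has_root by blast
      \<comment> \<open>Up to a power of the leading coefficient every relation of y is a multiple
        of f, since its remainder vanishes at y and has too small a degree.\<close>
      have "poly (map_poly \<phi> g) d = 0" if g: "poly_over A g" "poly g y = 0" for g
      proof -
        obtain k q r where kqr: "poly_over A q" "poly_over A r"
          "smult (lead_coeff f ^ k) g = f * q + r" "r = 0 \<or> degree r < degree f"
          using pseudo_division_over[OF A f(1,2) g(1)] by blast
        have "poly r y = 0" using arg_cong[OF kqr(3), of "\<lambda>p. poly p y"] f g by simp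
        then have "r = 0" using small kqr by auto
        then have fq: "smult (lead_coeff f ^ k) g = f * q" using kqr by simp
        have "smult (\<phi> (lead_coeff f) ^ k) (map_poly \<phi> g) = map_poly \<phi> (smult (lead_coeff f ^ k) g)"
          using g lf by (simp add: map_hom_smult[OF A \<phi>(1)] hom_on_power[OF A \<phi>(1)] subring_power[OF A])
        also have "\<dots> = map_poly \<phi> f * map_poly \<phi> q"
          unfolding fq using f kqr by (simp add: map_hom_mult[OF A \<phi>(1)])
        finally have "smult (\<phi> (lead_coeff f) ^ k) (map_poly \<phi> g) = map_poly \<phi> f * map_poly \<phi> q" .
        from arg_cong[OF this, of "\<lambda>p. poly p d"] show ?thesis using d ne by simp
      qed
      from hom_extend[OF A \<phi>(1) this] obtain \<psi> where \<psi>: "hom_on (adjoin A y) \<psi>" "\<forall>x\<in>A. \<psi> x = \<phi> x"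
        by blast
      have "\<psi> u * \<psi> (poly z y) = \<psi> g0"
        using hom_onD(3)[OF \<psi>(1) u(1) adjoinI[OF A z(1)]] z(2) g0 by simp
      then have "\<psi> u \<noteq> 0" using \<psi> ne g0A by auto
      with \<psi> show "\<exists>\<psi>. hom_on (adjoin A y) \<psi> \<and> (\<forall>x\<in>A. \<psi> x = \<phi> x) \<and> \<psi> u \<noteq> 0" by blast
    qed
  qed
qed

text \<open>The B built here is A[y_0, ..., y_(b-1)], one generator at a time. Geometrically, the
  K-points of A that lift to a K-point of B with u nonzero contain the principal open set of a
  nonzero h, as in Chevalley's theorem.\<close>

lemma finitely_generated_homs_extend:
  fixes A :: "'r::idom set" and y :: "nat \<Rightarrow> 'r"
  assumes A: "is_subring A"
  shows "\<exists>B. is_subring B \<and> A \<subseteq> B \<and> (\<forall>i<b. y i \<in> B) \<and>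
    (\<forall>u\<in>B. u \<noteq> 0 \<longrightarrow> homs_extend TYPE('k::{alg_closed_field, field_char_0}) A B u)"
proof (induction b)
  case 0
  have "homs_extend TYPE('k) A A u" if "u \<in> A" "u \<noteq> 0" for u
    unfolding homs_extend_def using that by (intro bexI[of _ u]) auto
  then show ?case using A by (intro exI[of _ A]) simp
next
  case (Suc b)
  then obtain B where B: "is_subring B" "A \<subseteq> B" "\<forall>i<b. y i \<in> B"
    "\<forall>u\<in>B. u \<noteq> 0 \<longrightarrow> homs_extend TYPE('k) A B u" by (elim exE conjE)
  let ?C = "adjoin B (y b)"
  have C: "is_subring ?C" "B \<subseteq> ?C" "y b \<in> ?C"
    using is_subring_adjoin[OF B(1)] adjoin_base[OF B(1)] adjoin_generator[OF B(1)] by auto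
  have "homs_extend TYPE('k) A ?C u" if "u \<in> ?C" "u \<noteq> 0" for u
    using homs_extend_trans[OF B(2) adjoin_step[OF B(1) that]] B(4) by blast
  then show ?case using B C by (intro exI[of _ ?C]) (auto simp: less_Suc_eq)
qed

subsection \<open>Power series solutions\<close>

text \<open>Congruence modulo the k-th power of the variable.\<close>

definition fps_agree :: "nat \<Rightarrow> 'a fps \<Rightarrow> 'a fps \<Rightarrow> bool" where
  "fps_agree k a b \<longleftrightarrow> (\<forall>l<k. fps_nth a l = fps_nth b l)"

lemma fps_agree_add: "fps_agree k a b \<Longrightarrow> fps_agree k a' b' \<Longrightarrow> fps_agree k (a + a') (b + b')"
  by (simp add: fps_agree_def)

lemma fps_agree_mult:
  "fps_agree k a b \<Longrightarrow> fps_agree k a' b' \<Longrightarrow> fps_agree k (a * a') (b * b' :: 'a::comm_ring_1 fps)"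
  unfolding fps_agree_def fps_mult_nth by (intro allI impI sum.cong) auto

lemma fps_agree_peval:
  "(\<And>i. fps_agree k (y i) (z i)) \<Longrightarrow> fps_agree k (peval c y e) (peval c z e :: 'a::comm_ring_1 fps)"
  by (induction e) (auto simp: fps_agree_add fps_agree_mult, simp add: fps_agree_def)

text \<open>A factor without constant term shifts degrees by one, so one more coefficient agrees.
  This makes the fixed-point map below contracting.\<close>

lemma fps_agree_small_mult:
  assumes "fps_agree k a b" "fps_nth x 0 = 0"
  shows "fps_agree (Suc k) (x * a) (x * b :: 'a::comm_ring_1 fps)"
  unfolding fps_agree_def fps_mult_nth
proof (intro allI impI sum.cong refl)
  fix l i assume "l < Suc k" "i \<in> {0..l}"
  then show "fps_nth x i * fps_nth a (l - i) = fps_nth x i * fps_nth b (l - i)"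
    using assms by (cases i) (auto simp: fps_agree_def)
qed

lemma fps_agree_sum:
  "(\<And>j. j \<in> J \<Longrightarrow> fps_agree k (a j) (b j)) \<Longrightarrow> fps_agree k (sum a J) (sum b J :: 'a::comm_ring_1 fps)"
  by (auto simp: fps_agree_def fps_sum_nth intro!: sum.cong)

text \<open>As every \<open>X j\<close> lacks a constant term, the right side is a contraction for
  the adic distance; its iterates from 0 converge coefficientwise to a solution.\<close>

lemma fps_system_solvable:
  fixes X :: "nat \<Rightarrow> 'r::comm_ring_1 fps"
  assumes X: "\<And>j. fps_nth (X j) 0 = 0"
  shows "\<exists>y. \<forall>i. y i = (\<Sum>j<M. X j * peval c y (f i j))"
proof -
  define T where "T y i = (\<Sum>j<M. X j * peval c y (f i j))" for y i
  have T: "fps_agree (Suc k) (T y i) (T z i)" if "\<And>i. fps_agree k (y i) (z i)" for k y z i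
    unfolding T_def by (intro fps_agree_sum fps_agree_small_mult fps_agree_peval that X)
  define Y where "Y k = (T ^^ k) (\<lambda>_. 0)" for k
  have Y: "fps_agree k (Y k i) (Y (k + n) i)" for k n i
  proof (induction k arbitrary: i)
    case 0
    show ?case by (simp add: fps_agree_def)
  next
    case (Suc k)
    have "Y (Suc k) = T (Y k)" "Y (Suc k + n) = T (Y (k + n))" by (simp_all add: Y_def)
    then show ?case using T[OF Suc] by simp
  qed
  \<comment> \<open>Coefficient l is final from iterate l + 1 on.\<close>
  define y where "y i = Abs_fps (\<lambda>l. fps_nth (Y (Suc l) i) l)" for i
  have y: "fps_agree k (y i) (Y k i)" for k i
    unfolding fps_agree_def
  proof (intro allI impI)
    fix l assume "l < k"
    then obtain n where "k = Suc l + n" using less_iff_Suc_add by auto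
    then show "fps_nth (y i) l = fps_nth (Y k i) l"
      using Y[of "Suc l" i n] by (simp add: y_def fps_agree_def)
  qed
  have "y i = T y i" for i
  proof (rule fps_ext)
    fix l
    \<comment> \<open>Agreement of y with \<open>Y l\<close> below degree l becomes agreement
      through degree l after T.\<close>
    have "fps_nth (T y i) l = fps_nth (T (Y l) i) l" using T[of l y "Y l" i] y by (simp add: fps_agree_def)
    also have "T (Y l) = Y (Suc l)" by (simp add: Y_def)
    finally show "fps_nth (y i) l = fps_nth (T y i) l" using y[of "Suc l" i] by (simp add: fps_agree_def)
  qed
  then show ?thesis unfolding T_def by blast
qed

lemma hom_on_peval:
  fixes \<psi> :: "'r::comm_ring_1 \<Rightarrow> 'k::comm_ring_1"
  assumes B: "is_subring B" "hom_on B \<psi>" and c: "\<And>a. c a \<in> B" "\<And>a. \<psi> (c a) = a" and y: "\<And>i. y i \<in> B"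
  shows "peval c y e \<in> B \<and> \<psi> (peval c y e) = peval (\<lambda>x. x) (\<lambda>i. \<psi> (y i)) e"
  by (induction e) (auto simp: c y hom_onD[OF B(2)] is_subringD[OF B(1)])

lemma generic_system_solvable:
  fixes f :: "nat \<Rightarrow> nat \<Rightarrow> 'k::{alg_closed_field, field_char_0} pexp"
  shows "\<exists>H. (\<exists>c. peval (\<lambda>x. x) c H \<noteq> 0) \<and> (\<forall>c. peval (\<lambda>x. x) c H \<noteq> 0 \<longrightarrow>
    (\<exists>a. \<forall>i<b. a i = (\<Sum>j<M. c j * peval (\<lambda>x. x) a (f i j))))"
proof -
  \<comment> \<open>The power series system is solved for all indices at once. The zero equations
    for i >= b make \<open>y i\<close> vanish there, so that every \<open>y i\<close> lies in
    B.\<close>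
  define f' where "f' i j = (if i < b then f i j else PConst 0)" for i j
  define \<iota> :: "'k \<Rightarrow> 'k polyfun fps" where "\<iota> c = fps_of_poly [:polyfun_const c:]" for c
  \<comment> \<open>\<open>X j\<close> is s x_j, and A below is the polynomial ring in s over the
    ring of polynomials in the x_j, seen inside power series.\<close>
  define X :: "nat \<Rightarrow> 'k polyfun fps" where "X j = fps_of_poly [:0, polyfun_var j:]" for j
  define A :: "'k polyfun fps set" where "A = range fps_of_poly"
  have A: "is_subring A"
    unfolding is_subring_def A_def
    by (auto simp: image_iff fps_of_poly_add[symmetric] fps_of_poly_mult[symmetric] fps_of_poly_uminus[symmetric]
        simp flip: fps_of_poly_1)
  obtain y where y: "\<And>i. y i = (\<Sum>j<M. X j * peval \<iota> y (f' i j))"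
    using fps_system_solvable[where X = X and M = M and c = \<iota> and f = f'] unfolding X_def by auto
  have y0: "y i = 0" if "i \<ge> b" for i
    using that by (subst y) (simp add: f'_def \<iota>_def polyfun_const_def zero_polyfun_def[symmetric])
  obtain B where B: "is_subring B" "A \<subseteq> B" "\<forall>i<b. y i \<in> B"
    "\<forall>u\<in>B. u \<noteq> 0 \<longrightarrow> homs_extend TYPE('k) A B u"
    using finitely_generated_homs_extend[OF A, where ?'k = 'k, of b y] by (elim exE conjE)
  \<comment> \<open>Taking u = 1 asks for the mere existence of an extension.\<close>
  have "homs_extend TYPE('k) A B 1" using B is_subringD(1)[OF B(1)] by simp
  then obtain h where "h \<in> A" "h \<noteq> 0" and ext: "\<And>\<phi> :: 'k polyfun fps \<Rightarrow> 'k. hom_on A \<phi> \<Longrightarrow> \<phi> h \<noteq> 0 \<Longrightarrow>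
      \<exists>\<psi>. hom_on B \<psi> \<and> (\<forall>x\<in>A. \<psi> x = \<phi> x)"
    unfolding homs_extend_def by metis
  then obtain g where g: "h = fps_of_poly g" "g \<noteq> 0" unfolding A_def by auto
  have inj: "inj (polyfun_const :: 'k \<Rightarrow> _)"
    by (rule injI) (metis polyfun_at_simps(5))
  \<comment> \<open>s will be specialised to a constant t. It must not be a root of g, so that g(t)
    remains a nonzero polynomial in the x_j, and it must be nonzero, so that c_j = t x_j can be
    solved for x_j.\<close>
  have "finite {t. poly g (polyfun_const t) = 0}"
    using finite_vimageI[OF poly_roots_finite[OF g(2)] inj] by (simp add: vimage_def)
  then have "\<exists>t. t \<notin> {t. poly g (polyfun_const t) = 0} \<union> {0}"
    using ex_new_if_finite[OF infinite_UNIV_char_0] by blast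
  then obtain t where t: "poly g (polyfun_const t) \<noteq> 0" "t \<noteq> 0" by auto
  obtain E where E: "\<And>v. polyfun_at v (poly g (polyfun_const t)) = peval (\<lambda>x. x) v E"
    using polyfun_peval by blast
  define H where "H = psubst (\<lambda>j. PMul (PConst (1 / t)) (PVar j)) E"
  have H: "peval (\<lambda>x. x) c H = polyfun_at (\<lambda>j. c j / t) (poly g (polyfun_const t))" for c
    by (simp add: H_def peval_psubst E)
  show ?thesis
  proof (intro exI[of _ H] conjI allI impI)
    obtain v where "polyfun_at v (poly g (polyfun_const t)) \<noteq> 0" using polyfun_nonzero t by blast
    then show "\<exists>c. peval (\<lambda>x. x) c H \<noteq> 0" using t
      by (intro exI[of _ "\<lambda>j. v j * t"]) (simp add: H)
  next
    fix c assume c: "peval (\<lambda>x. x) c H \<noteq> 0"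
    \<comment> \<open>Evaluation at s = t and x_j = c_j / t, which sends \<open>X j\<close> to
      \<open>c j\<close> and h to the value of H at c.\<close>
    define \<phi> where "\<phi> x = polyfun_at (\<lambda>j. c j / t) (poly (inv_into UNIV fps_of_poly x) (polyfun_const t))" for x
    have "inj (fps_of_poly :: 'k polyfun poly \<Rightarrow> _)" by (rule injI) (simp add: fps_of_poly_eq_iff)
    then have \<phi>: "\<phi> (fps_of_poly q) = polyfun_at (\<lambda>j. c j / t) (poly q (polyfun_const t))" for q
      by (simp add: \<phi>_def inv_f_f)
    have "hom_on A \<phi>" unfolding hom_on_def A_def
      by (auto simp: fps_of_poly_add[symmetric] fps_of_poly_mult[symmetric] \<phi> simp flip: fps_of_poly_1)
    moreover have "\<phi> h \<noteq> 0" using c by (simp add: g(1) \<phi> H)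
    ultimately obtain \<psi> where \<psi>: "hom_on B \<psi>" "\<forall>x\<in>A. \<psi> x = \<phi> x" using ext[of \<phi>] by blast
    have \<iota>: "\<iota> a \<in> B" "\<psi> (\<iota> a) = a" for a
      using B(2) \<psi>(2) by (auto simp: \<iota>_def A_def \<phi>)
    have X: "X j \<in> B" "\<psi> (X j) = c j" for j
      using B(2) \<psi>(2) t by (auto simp: X_def A_def \<phi>)
    have yB: "y i \<in> B" for i
      using B y0 is_subringD(2)[OF B(1)] by (cases "i < b") auto
    note ev = hom_on_peval[OF B(1) \<psi>(1) \<iota> yB]
    have sol: "\<psi> (y i) = (\<Sum>j<M. c j * peval (\<lambda>x. x) (\<lambda>i. \<psi> (y i)) (f' i j))" for i
      by (subst y) (simp add: hom_on_sum[OF B(1) \<psi>(1)] hom_onD(3)[OF \<psi>(1)] is_subringD(5)[OF B(1)] X ev)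
    have "\<psi> (y i) = (\<Sum>j<M. c j * peval (\<lambda>x. x) (\<lambda>i. \<psi> (y i)) (f i j))" if "i < b" for i
      using sol[of i] that by (simp only: f'_def if_True)
    then show "\<exists>a. \<forall>i<b. a i = (\<Sum>j<M. c j * peval (\<lambda>x. x) a (f i j))"
      by (intro exI[of _ "\<lambda>i. \<psi> (y i)"]) blast
  qed
qed

section \<open>Linear algebra: coordinates, polarisation weights, block matrices, GL_inf\<close>

subsection \<open>Linear functionals\<close>

abbreviation functional :: "('k::field, 'v) module \<Rightarrow> ('v \<Rightarrow> 'k) set" where
  "functional V \<equiv> LinearCombinations.module_hom class_ring V scalars"

lemma functional_iff:
  "l \<in> functional V \<longleftrightarrow>
    (\<forall>x\<in>carrier V. \<forall>y\<in>carrier V. l (x \<oplus>\<^bsub>V\<^esub> y) = l x + l y) \<and>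
    (\<forall>c. \<forall>x\<in>carrier V. l (c \<odot>\<^bsub>V\<^esub> x) = c * l x)"
  by (auto simp: LinearCombinations.module_hom_def scalars_def class_ring_simps)

lemma functional_add:
  "l \<in> functional V \<Longrightarrow> x \<in> carrier V \<Longrightarrow> y \<in> carrier V \<Longrightarrow> l (x \<oplus>\<^bsub>V\<^esub> y) = l x + l y"
  by (simp add: functional_iff)

lemma functional_smult: "l \<in> functional V \<Longrightarrow> x \<in> carrier V \<Longrightarrow> l (c \<odot>\<^bsub>V\<^esub> x) = c * l x"
  by (simp add: functional_iff)

lemma Hom_iff:
  "T \<in> Hom U V \<longleftrightarrow> T \<in> carrier U \<rightarrow>\<^sub>E carrier V \<and>
    (\<forall>x\<in>carrier U. \<forall>y\<in>carrier U. T (x \<oplus>\<^bsub>U\<^esub> y) = T x \<oplus>\<^bsub>V\<^esub> T y) \<and>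
    (\<forall>c. \<forall>x\<in>carrier U. T (c \<odot>\<^bsub>U\<^esub> x) = c \<odot>\<^bsub>V\<^esub> T x)"
  unfolding Hom_def PiE_def LinearCombinations.module_hom_def by (auto simp: class_ring_simps)

lemma functional_comp_Hom:
  "T \<in> Hom U V \<Longrightarrow> l \<in> functional V \<Longrightarrow> (\<lambda>x. l (T x)) \<in> functional U"
  unfolding Hom_iff functional_iff by (auto simp: PiE_iff)

lemma functional_eval:
  "x \<in> carrier U \<Longrightarrow> l \<in> functional V \<Longrightarrow> (\<lambda>T. l (T x)) \<in> functional (Hom_space U V)"
  by (auto simp: Hom_space_def Hom_iff functional_iff PiE_iff)

lemma VecD:
  fixes V :: "('k::field, 'v) module"
  assumes "V \<in> Vec"
  shows "vectorspace class_ring V" "vectorspace.fin_dim class_ring V"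
  using assms by (auto simp: Vec_def)

lemma Vec_closed:
  fixes V :: "('k::field, 'v) module"
  assumes "V \<in> Vec"
  shows "\<zero>\<^bsub>V\<^esub> \<in> carrier V" "x \<in> carrier V \<Longrightarrow> y \<in> carrier V \<Longrightarrow> x \<oplus>\<^bsub>V\<^esub> y \<in> carrier V"
    "x \<in> carrier V \<Longrightarrow> c \<odot>\<^bsub>V\<^esub> x \<in> carrier V"
proof -
  interpret vectorspace class_ring V using assms by (rule VecD)
  show "\<zero>\<^bsub>V\<^esub> \<in> carrier V" "x \<in> carrier V \<Longrightarrow> y \<in> carrier V \<Longrightarrow> x \<oplus>\<^bsub>V\<^esub> y \<in> carrier V"
    "x \<in> carrier V \<Longrightarrow> c \<odot>\<^bsub>V\<^esub> x \<in> carrier V" by (auto simp: class_ring_simps)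
qed

lemma functional_zero:
  fixes V :: "('k::field, 'v) module"
  assumes "V \<in> Vec" "l \<in> functional V"
  shows "l \<zero>\<^bsub>V\<^esub> = 0"
proof -
  interpret vectorspace class_ring V using assms by (auto dest: VecD)
  show ?thesis using functional_add[OF assms(2), of "\<zero>\<^bsub>V\<^esub>" "\<zero>\<^bsub>V\<^esub>"]
    by (metis M.zero_closed M.l_zero add_cancel_right_right)
qed

text \<open>The combination is described through functionals, the form in which coordinates are
  computed later, in place of a finite sum in V.\<close>

lemma linear_combination_exists:
  fixes V :: "('k::field, 'v) module"
  assumes V: "V \<in> Vec" and "finite S" and v: "\<And>s. s \<in> S \<Longrightarrow> v s \<in> carrier V"
  shows "\<exists>x\<in>carrier V. \<forall>l\<in>functional V. l x = (\<Sum>s\<in>S. w s * l (v s))"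
  using assms(2) v
proof (induction S)
  case empty
  show ?case using Vec_closed(1)[OF V] functional_zero[OF V] by (intro bexI[of _ "\<zero>\<^bsub>V\<^esub>"]) auto
next
  case (insert s S)
  then obtain x where "x \<in> carrier V" "\<forall>l\<in>functional V. l x = (\<Sum>s\<in>S. w s * l (v s))" by auto
  moreover have "v s \<in> carrier V" using insert by simp
  ultimately show ?case using insert.hyps
    by (intro bexI[of _ "w s \<odot>\<^bsub>V\<^esub> v s \<oplus>\<^bsub>V\<^esub> x"] Vec_closed[OF V])
      (auto simp: functional_add functional_smult Vec_closed[OF V])
qed

definition dual_basis :: "('k::field, 'v) module \<Rightarrow> nat \<Rightarrow> (nat \<Rightarrow> 'v) \<Rightarrow> (nat \<Rightarrow> 'v \<Rightarrow> 'k) \<Rightarrow> bool" where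
  "dual_basis V M e \<mu> \<longleftrightarrow>
    (\<forall>i<M. e i \<in> carrier V \<and> \<mu> i \<in> functional V) \<and>
    (\<forall>i<M. \<forall>j<M. \<mu> i (e j) = (if i = j then 1 else 0)) \<and>
    (\<forall>l\<in>functional V. \<forall>x\<in>carrier V. l x = (\<Sum>i<M. \<mu> i x * l (e i))) \<and>
    (\<forall>x\<in>carrier V. \<forall>y\<in>carrier V. (\<forall>i<M. \<mu> i x = \<mu> i y) \<longrightarrow> x = y)"

lemma dual_basisD:
  assumes "dual_basis V M e \<mu>"
  shows "i < M \<Longrightarrow> e i \<in> carrier V" "i < M \<Longrightarrow> \<mu> i \<in> functional V"
    "i < M \<Longrightarrow> j < M \<Longrightarrow> \<mu> i (e j) = (if i = j then 1 else 0)"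
    "l \<in> functional V \<Longrightarrow> x \<in> carrier V \<Longrightarrow> l x = (\<Sum>i<M. \<mu> i x * l (e i))"
    "x \<in> carrier V \<Longrightarrow> y \<in> carrier V \<Longrightarrow> (\<And>i. i < M \<Longrightarrow> \<mu> i x = \<mu> i y) \<Longrightarrow> x = y"
  using assms unfolding dual_basis_def by blast+

text \<open>Coordinates in a finite basis are unique (\<open>basis_criterion\<close>), and
  uniqueness gives both their linearity and their values on the basis. The bijection h then numbers
  the basis.\<close>

lemma dual_basis_exists:
  fixes V :: "('k::field, 'v) module"
  assumes V: "V \<in> Vec"
  shows "\<exists>M e \<mu>. dual_basis V M e \<mu>"
proof -
  interpret vectorspace class_ring V using V by (rule VecD)
  obtain A where A: "finite A" "basis A" using finite_basis_exists VecD[OF V] by blast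
  then have AV: "A \<subseteq> carrier V" by (simp add: basis_def)
  have K: "carrier (class_ring :: 'k ring) = UNIV" by (simp add: class_ring_simps)
  have uniq: "\<exists>!a. a \<in> A \<rightarrow>\<^sub>E UNIV \<and> lincomb a A = x" if "x \<in> carrier V" for x
    using basis_criterion[OF A(1) AV] A(2) that unfolding K by blast
  have restr: "lincomb (restrict a A) A = lincomb a A" for a :: "'v \<Rightarrow> 'k"
    by (rule lincomb_cong) (auto simp: AV K)
  define co where "co x = (THE a. a \<in> A \<rightarrow>\<^sub>E UNIV \<and> lincomb a A = x)" for x
  have co: "lincomb (co x) A = x" if "x \<in> carrier V" for x
    using theI'[OF uniq[OF that]] unfolding co_def by blast
  have co_eq: "co (lincomb a A) v = a v" if "v \<in> A" for a v
  proof -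
    have "lincomb a A \<in> carrier V" by (rule lincomb_closed) (auto simp: AV K)
    from the1_equality[OF uniq[OF this], of "restrict a A"] show ?thesis
      using that by (simp add: co_def restr)
  qed
  have l_lincomb: "l (lincomb a B) = (\<Sum>v\<in>B. a v * l v)"
    if "B \<subseteq> A" and l: "l \<in> functional V" for B a l
    using finite_subset[OF that(1) A(1)] that(1)
  proof (induction B)
    case empty
    show ?case using functional_zero[OF V l] by (simp add: lincomb_def)
  next
    case (insert v B)
    then have "v \<in> carrier V" "B \<subseteq> carrier V" using AV by auto
    then have "lincomb a (insert v B) = a v \<odot>\<^bsub>V\<^esub> v \<oplus>\<^bsub>V\<^esub> lincomb a B"
      using lincomb_insert[OF insert.hyps(1), of a v] insert.hyps by (simp add: K)
    moreover have "lincomb a B \<in> carrier V" using \<open>B \<subseteq> carrier V\<close> by (auto simp: K intro: lincomb_closed)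
    ultimately show ?case using insert \<open>v \<in> carrier V\<close> l
      by (simp add: functional_add functional_smult Vec_closed[OF V])
  qed
  have co_lin: "(\<lambda>x. co x v) \<in> functional V" if v: "v \<in> A" for v
    unfolding functional_iff
  proof (intro conjI ballI allI)
    fix x y assume xy: "x \<in> carrier V" "y \<in> carrier V"
    have "x \<oplus>\<^bsub>V\<^esub> y = lincomb (\<lambda>v. co x v + co y v) A"
      using lincomb_sum[OF A(1) AV, of "co x" "co y"] co xy by (simp add: K class_ring_simps)
    then show "co (x \<oplus>\<^bsub>V\<^esub> y) v = co x v + co y v" using co_eq[OF v] by simp
  next
    fix c x assume x: "x \<in> carrier V"
    have "c \<odot>\<^bsub>V\<^esub> x = lincomb (\<lambda>v. c * co x v) A"
      using lincomb_smult[OF AV, of "co x" c] co x by (simp add: K class_ring_simps)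
    then show "co (c \<odot>\<^bsub>V\<^esub> x) v = c * co x v" using co_eq[OF v] by simp
  qed
  have co_basis: "co u v = (if v = u then 1 else 0)" if "u \<in> A" "v \<in> A" for u v
  proof -
    define a where "a w = (if w = u then 1 else 0 :: 'k)" for w
    have inC: "u \<in> carrier V" "lincomb a A \<in> carrier V" using AV that by (auto simp: K intro: lincomb_closed)
    have "lincomb (co u) A = lincomb a A"
    proof -
      have "lincomb a A = a u \<odot>\<^bsub>V\<^esub> u \<oplus>\<^bsub>V\<^esub> lincomb a (A - {u})"
        by (rule lincomb_del2) (use A AV that in \<open>auto simp: K\<close>)
      also have "lincomb a (A - {u}) = lincomb (\<lambda>_. \<zero>\<^bsub>class_ring\<^esub>) (A - {u})"
        by (rule lincomb_cong) (use AV in \<open>auto simp: K a_def class_ring_simps\<close>)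
      also have "\<dots> = \<zero>\<^bsub>V\<^esub>" unfolding lincomb_def
        using AV lmult_0 by (intro finsum_all0) (auto simp: class_ring_simps subset_iff)
      also have "a u = 1" by (simp add: a_def)
      finally have "lincomb a A = u"
        using inC(1) smult_one[OF inC(1)] by (simp add: class_ring_simps)
      then show ?thesis using co[OF inC(1)] by simp
    qed
    then have "u = lincomb a A" using co inC by simp
    then show ?thesis using co_eq[OF that(2), of a] by (simp add: a_def)
  qed
  obtain h where h: "bij_betw h {0..<card A} A" using ex_bij_betw_nat_finite[OF A(1)] by blast
  have hA: "h i \<in> A" if "i < card A" for i using h that by (auto simp: bij_betw_def)
  have h_eq: "h i = h j \<longleftrightarrow> i = j" if "i < card A" "j < card A" for i j
    using h that by (auto simp: bij_betw_def inj_on_def)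
  have "dual_basis V (card A) h (\<lambda>i x. co x (h i))"
    unfolding dual_basis_def
  proof (intro conjI allI impI ballI)
    show "h i \<in> carrier V" "(\<lambda>x. co x (h i)) \<in> functional V" if "i < card A" for i
      using hA[OF that] AV co_lin by auto
    show "co (h j) (h i) = (if i = j then 1 else 0)" if "i < card A" "j < card A" for i j
      using that by (simp add: co_basis hA h_eq)
    show "l x = (\<Sum>i<card A. co x (h i) * l (h i))" if "l \<in> functional V" "x \<in> carrier V" for l x
    proof -
      have "l x = (\<Sum>v\<in>A. co x v * l v)" using l_lincomb[of A l "co x"] co that by simp
      also have "\<dots> = (\<Sum>i\<in>{0..<card A}. co x (h i) * l (h i))"
        using sum.reindex_bij_betw[OF h, of "\<lambda>v. co x v * l v"] by simp
      finally show ?thesis by (simp add: atLeast0LessThan)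
    qed
    fix x y assume xy: "x \<in> carrier V" "y \<in> carrier V" "\<forall>i<card A. co x (h i) = co y (h i)"
    have "co x v = co y v" if "v \<in> A" for v
      using h that xy(3) unfolding bij_betw_def by (metis atLeastLessThan_iff imageE)
    then have "lincomb (co x) A = lincomb (co y) A" by (intro lincomb_cong) (auto simp: AV K)
    then show "x = y" using co xy by simp
  qed
  then show ?thesis by blast
qed

subsection \<open>Polarisation weights\<close>

text \<open>The nodes 0, ..., d are distinct in characteristic zero. On polynomials of degree at
  most d the functional x^i -> c i is therefore a combination of evaluations at the nodes, and the
  weight at k is its value on the Lagrange polynomial \<open>L k\<close>.\<close>

lemma moments_solvable:
  fixes c :: "nat \<Rightarrow> 'k::field_char_0"
  shows "\<exists>w. \<forall>i\<le>d. (\<Sum>k\<le>d. w k * of_nat k ^ i) = c i"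
proof -
  define L where "L k = (\<Prod>l\<in>{..d} - {k}. smult (1 / (of_nat k - of_nat l)) [:- of_nat l, 1 :: 'k:])" for k
  have L: "poly (L k) (of_nat l) = (if k = l then 1 else 0)" if "k \<le> d" "l \<le> d" for k l
  proof (cases "k = l")
    case True
    then show ?thesis unfolding L_def by (auto simp: poly_prod divide_simps intro!: prod.neutral)
  next
    case False
    then have "l \<in> {..d} - {k}" using that by auto
    then show ?thesis using False unfolding L_def poly_prod
      by (auto intro!: prod_zero bexI[of _ l])
  qed
  have deg: "degree (L k) \<le> d" if "k \<le> d" for k
  proof -
    have "degree (L k) \<le> (\<Sum>l\<in>{..d} - {k}. degree (smult (1 / (of_nat k - of_nat l)) [:- of_nat l, 1 :: 'k:]))"
      unfolding L_def by (rule degree_prod_sum_le[unfolded comp_def]) simp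
    also have "\<dots> \<le> (\<Sum>l\<in>{..d} - {k}. 1)" by (intro sum_mono) simp
    also have "\<dots> = d" using that by simp
    finally show ?thesis .
  qed
  \<comment> \<open>Interpolating x^i at d + 1 nodes returns x^i, as its degree is at most
    d.\<close>
  have monom: "(\<Sum>k\<le>d. smult (of_nat k ^ i) (L k)) = monom 1 i" if i: "i \<le> d" for i
  proof (rule poly_eqI_degree[of "of_nat ` {..d}"])
    fix x :: 'k assume "x \<in> of_nat ` {..d}"
    then obtain l where l: "l \<le> d" "x = of_nat l" by auto
    have "(\<Sum>k\<le>d. of_nat k ^ i * poly (L k) x) = (\<Sum>k\<le>d. if k = l then of_nat k ^ i else 0)"
      by (intro sum.cong) (auto simp: L l)
    then show "poly (\<Sum>k\<le>d. smult (of_nat k ^ i) (L k)) x = poly (monom 1 i) x"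
      using l by (simp add: poly_sum poly_monom)
  next
    have card: "card (of_nat ` {..d} :: 'k set) = Suc d" by (simp add: card_image inj_on_def)
    have "degree (\<Sum>k\<le>d. smult (of_nat k ^ i :: 'k) (L k)) \<le> d"
      by (intro degree_sum_le order.trans[OF degree_smult_le] deg) auto
    then show "degree (\<Sum>k\<le>d. smult (of_nat k ^ i) (L k)) < card (of_nat ` {..d} :: 'k set)" using card by simp
    show "degree (monom (1::'k) i) < card (of_nat ` {..d} :: 'k set)" using card i by (simp add: degree_monom_eq)
  qed
  define w where "w k = (\<Sum>j\<le>d. c j * coeff (L k) j)" for k
  have "(\<Sum>k\<le>d. w k * of_nat k ^ i) = c i" if i: "i \<le> d" for i
  proof -
    have "(\<Sum>k\<le>d. w k * of_nat k ^ i) = (\<Sum>k\<le>d. \<Sum>j\<le>d. c j * (of_nat k ^ i * coeff (L k) j))"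
      unfolding w_def sum_distrib_right by (intro sum.cong refl) (simp add: mult.commute mult.left_commute)
    also have "\<dots> = (\<Sum>j\<le>d. c j * coeff (\<Sum>k\<le>d. smult (of_nat k ^ i) (L k)) j)"
      by (subst sum.swap) (simp add: coeff_sum sum_distrib_left)
    also have "\<dots> = (\<Sum>j\<le>d. if j = i then c j else 0)"
      unfolding monom[OF i] by (intro sum.cong) auto
    also have "\<dots> = c i" using i by simp
    finally show ?thesis .
  qed
  then show ?thesis by blast
qed

text \<open>P is not split into homogeneous parts, so one set of weights must serve every degree i
  from 1 to d. With \<alpha> s + \<beta> s a = l (k a + 1), the weights in k extract i a from the
  i-th power, and the weights in l, with moments 1 / i, cancel the factor i.\<close>

lemma polarisation_weights:
  "\<exists>(w :: nat \<times> nat \<Rightarrow> 'k::field_char_0) \<alpha> \<beta>. \<forall>i\<in>{1..d}. \<forall>a.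
    (\<Sum>s\<in>{..d} \<times> {..d}. w s * (\<alpha> s + \<beta> s * a) ^ i) = a"
proof -
  obtain w :: "nat \<Rightarrow> 'k" where w: "\<And>i. i \<le> d \<Longrightarrow> (\<Sum>k\<le>d. w k * of_nat k ^ i) = (if i = 1 then 1 else 0)"
    using moments_solvable[of d "\<lambda>i. if i = 1 then 1 else 0"] by blast
  \<comment> \<open>For i = 0 the prescribed moment is the default value 1 / 0 = 0.\<close>
  obtain u :: "nat \<Rightarrow> 'k" where u: "\<And>i. i \<le> d \<Longrightarrow> (\<Sum>k\<le>d. u k * of_nat k ^ i) = 1 / of_nat i"
    using moments_solvable[of d "\<lambda>i. 1 / of_nat i"] by blast
  \<comment> \<open>In the binomial expansion the moments of w keep only the term linear in
    a.\<close>
  have inner: "(\<Sum>k\<le>d. w k * (of_nat k * a + 1) ^ i) = of_nat i * a" if i: "i \<in> {1..d}" for i a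
  proof -
    have "(\<Sum>k\<le>d. w k * (of_nat k * a + 1) ^ i) =
        (\<Sum>k\<le>d. \<Sum>j\<le>i. of_nat (i choose j) * a ^ j * (w k * of_nat k ^ j))"
      by (intro sum.cong refl) (simp add: binomial_ring sum_distrib_left power_mult_distrib mult_ac)
    also have "\<dots> = (\<Sum>j\<le>i. of_nat (i choose j) * a ^ j * (\<Sum>k\<le>d. w k * of_nat k ^ j))"
      by (subst sum.swap) (simp add: sum_distrib_left)
    also have "\<dots> = (\<Sum>j\<le>i. if j = 1 then of_nat (i choose j) * a ^ j else 0)"
      using i by (intro sum.cong refl) (simp add: w)
    also have "\<dots> = of_nat i * a" using i by simp
    finally show ?thesis .
  qed
  have "(\<Sum>s\<in>{..d} \<times> {..d}. (u (fst s) * w (snd s)) * (of_nat (fst s) + of_nat (fst s) * of_nat (snd s) * a) ^ i) = a"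
    if i: "i \<in> {1..d}" for i a
  proof -
    have "(\<Sum>s\<in>{..d} \<times> {..d}. (u (fst s) * w (snd s)) * (of_nat (fst s) + of_nat (fst s) * of_nat (snd s) * a) ^ i) =
      (\<Sum>l\<le>d. \<Sum>k\<le>d. u l * of_nat l ^ i * (w k * (of_nat k * a + 1) ^ i))"
      unfolding sum.cartesian_product
      by (intro sum.cong refl)
        (auto simp: power_mult_distrib[symmetric] algebra_simps simp del: of_nat_mult of_nat_add)
    also have "\<dots> = (\<Sum>l\<le>d. u l * of_nat l ^ i) * (of_nat i * a)"
      unfolding sum_distrib_left[symmetric] inner[OF i] by (simp add: sum_distrib_right)
    also have "\<dots> = a" using i by (simp add: u)
    finally show ?thesis .
  qed
  then show ?thesis
    by (intro exI[of _ "\<lambda>s. u (fst s) * w (snd s)"] exI[of _ "\<lambda>s. of_nat (fst s)"]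
      exI[of _ "\<lambda>s. of_nat (fst s) * of_nat (snd s)"]) simp
qed

subsection \<open>Polynomial functions along families\<close>

abbreviation polyfuns :: "((nat \<Rightarrow> 'k::comm_ring_1) \<Rightarrow> 'k) set" where
  "polyfuns \<equiv> range (\<lambda>e v. peval (\<lambda>x. x) v e)"

lemma polyfuns_var: "(\<lambda>v. v i) \<in> polyfuns"
  by (rule range_eqI[of _ _ "PVar i"]) simp

lemma polyfuns_sum: "(\<And>i. i \<in> I \<Longrightarrow> f i \<in> polyfuns) \<Longrightarrow> (\<lambda>v. \<Sum>i\<in>I. f i v) \<in> polyfuns"
proof (induction I rule: infinite_finite_induct)
  case (insert i I)
  then have "(\<lambda>v. f i v + (\<Sum>i\<in>I. f i v)) \<in> polyfuns" by (intro range_peval_add) auto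
  with insert.hyps show ?case by simp
qed (use range_peval_const[of 0] in simp_all)

lemma poly_fun_family:
  assumes "poly_fun V d f" "\<And>L. L \<in> functional V \<Longrightarrow> (\<lambda>a. L (\<gamma> a)) \<in> polyfuns"
  shows "(\<lambda>a. f (\<gamma> a)) \<in> polyfuns"
  using assms by (induction rule: poly_fun.induct)
    (auto intro: range_peval_add range_peval_mult range_peval_const)

text \<open>Along a line through the origin each linear functional contributes a single factor u, so
  the degree bound passes to g. The bound matters because the polarisation weights depend on
  d.\<close>

lemma poly_fun_line:
  assumes "poly_fun V d f" "\<And>L. L \<in> functional V \<Longrightarrow> \<exists>c. \<forall>u. L (\<gamma> u) = u * c"
  shows "\<exists>g. degree g \<le> d \<and> (\<forall>u. f (\<gamma> u) = poly g u)"
  using assms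
proof (induction rule: poly_fun.induct)
  case (const d c)
  show ?case by (rule exI[of _ "[:c:]"]) simp
next
  case (add d f g)
  then obtain p q where "degree p \<le> d" "\<forall>u. f (\<gamma> u) = poly p u" "degree q \<le> d" "\<forall>u. g (\<gamma> u) = poly q u"
    by metis
  then show ?case by (intro exI[of _ "p + q"]) (auto intro: degree_add_le)
next
  case (mult l d f)
  then obtain p c where "degree p \<le> d" "\<forall>u. f (\<gamma> u) = poly p u" "\<forall>u. l (\<gamma> u) = u * c"
    by metis
  then show ?case
    by (intro exI[of _ "pCons 0 (smult c p)"]) (auto simp: degree_pCons_eq_if)
qed

lemma poly_fun_functional: "l \<in> functional V \<Longrightarrow> poly_fun V 1 l"
  using poly_fun.mult[where V = V and l = l and d = 0 and f = "\<lambda>_. 1"] poly_fun.const[of V 0 1] by simp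

lemma poly_fun_peval:
  assumes "\<And>j. \<exists>d. poly_fun V d (c j)"
  shows "\<exists>d. poly_fun V d (\<lambda>x. peval (\<lambda>x. x) (\<lambda>j. c j x) e)"
proof (induction e)
  case (PConst a)
  show ?case using poly_fun.const by auto
next
  case (PVar i)
  show ?case using assms by simp
next
  case (PAdd e f)
  then obtain d d' where "poly_fun V d (\<lambda>x. peval (\<lambda>x. x) (\<lambda>j. c j x) e)"
    "poly_fun V d' (\<lambda>x. peval (\<lambda>x. x) (\<lambda>j. c j x) f)" by blast
  then have "poly_fun V (max d d') (\<lambda>x. peval (\<lambda>x. x) (\<lambda>j. c j x) e + peval (\<lambda>x. x) (\<lambda>j. c j x) f)"
    by (intro poly_fun.add) (auto intro: poly_fun_mono)
  then show ?case by auto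
next
  case (PMul e f)
  then show ?case using poly_fun_times by (fastforce simp del: split_paired_Ex)
qed

subsection \<open>Linear maps given by matrices\<close>

definition mmap :: "'k::field mat \<Rightarrow> 'k vec \<Rightarrow> 'k vec" where
  "mmap A = (\<lambda>v\<in>carrier_vec (dim_col A). A *\<^sub>v v)"

lemma mmap_Hom: "A \<in> carrier_mat n m \<Longrightarrow> mmap A \<in> Hom (K_pow m) (K_pow n)"
  using mult_add_distrib_mat_vec[of A n m] mult_mat_vec[of A n m]
  by (auto simp: Hom_iff mmap_def module_vec_simps)

lemma mmap_compose:
  assumes "A \<in> carrier_mat n m" "B \<in> carrier_mat k n"
  shows "compose (carrier_vec m) (mmap B) (mmap A) = mmap (B * A)"
  using assms assoc_mult_mat_vec[of B k n A m] by (auto simp: compose_def mmap_def fun_eq_iff)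

lemma mmap_one: "mmap (1\<^sub>m n) = (\<lambda>x\<in>carrier (K_pow n). x)"
  by (auto simp: mmap_def module_vec_simps fun_eq_iff)

lemma mat_map_eq_mmap: "mat_map n g = mmap (corner n g)"
  by (simp add: mat_map_def mmap_def corner_def)

lemma functional_mmap_add:
  assumes L: "L \<in> functional (Hom_space (K_pow m) (K_pow n))" and "A \<in> carrier_mat n m" "B \<in> carrier_mat n m"
  shows "L (mmap (A + B)) = L (mmap A) + L (mmap B)"
proof -
  have "mmap (A + B) = mmap A \<oplus>\<^bsub>Hom_space (K_pow m) (K_pow n)\<^esub> mmap B"
    using assms add_mult_distrib_mat_vec[of A n m B]
    by (auto simp: Hom_space_def mmap_def module_vec_simps fun_eq_iff)
  moreover have "mmap A \<in> carrier (Hom_space (K_pow m) (K_pow n))" "mmap B \<in> carrier (Hom_space (K_pow m) (K_pow n))"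
    using mmap_Hom assms by (auto simp: Hom_space_def)
  ultimately show ?thesis using functional_add[OF L] by simp
qed

lemma functional_mmap_smult:
  assumes L: "L \<in> functional (Hom_space (K_pow m) (K_pow n))" and A: "A \<in> carrier_mat n m"
  shows "L (mmap (c \<cdot>\<^sub>m A)) = c * L (mmap A)"
proof -
  have "mmap (c \<cdot>\<^sub>m A) = c \<odot>\<^bsub>Hom_space (K_pow m) (K_pow n)\<^esub> mmap A"
    using A by (auto simp: Hom_space_def mmap_def module_vec_simps fun_eq_iff intro!: eq_vecI)
  moreover have "mmap A \<in> carrier (Hom_space (K_pow m) (K_pow n))"
    using mmap_Hom A by (auto simp: Hom_space_def)
  ultimately show ?thesis using functional_smult[OF L] by simp
qed

text \<open>A vector of length \<open>n (b + 1)\<close> consists of blocks number \<open>0, \<dots>, b\<close> of length \<open>n\<close>: its coordinate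
  \<open>s\<close> is coordinate \<open>s mod n\<close> of block \<open>s div n\<close>.\<close>

definition row_blocks :: "nat \<Rightarrow> nat \<Rightarrow> (nat \<Rightarrow> 'k::field) \<Rightarrow> 'k mat" where
  "row_blocks n b \<alpha> = mat n (n * Suc b) (\<lambda>(r, s). if s mod n = r then \<alpha> (s div n) else 0)"

definition col_blocks :: "nat \<Rightarrow> nat \<Rightarrow> (nat \<Rightarrow> 'k::field) \<Rightarrow> 'k mat" where
  "col_blocks n b \<beta> = mat (n * Suc b) n (\<lambda>(s, c). if s mod n = c then \<beta> (s div n) else 0)"

lemma blocks_carrier [simp]:
  "row_blocks n b \<alpha> \<in> carrier_mat n (n * Suc b)" "col_blocks n b \<beta> \<in> carrier_mat (n * Suc b) n"
  by (simp_all add: row_blocks_def col_blocks_def)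

lemma blocks_mult:
  assumes "n \<ge> 1"
  shows "row_blocks n b \<alpha> * col_blocks n b \<beta> = (\<Sum>j\<le>b. \<alpha> j * \<beta> j) \<cdot>\<^sub>m 1\<^sub>m n"
proof (rule eq_matI)
  fix r c assume "r < dim_row ((\<Sum>j\<le>b. \<alpha> j * \<beta> j) \<cdot>\<^sub>m 1\<^sub>m n)" "c < dim_col ((\<Sum>j\<le>b. \<alpha> j * \<beta> j) \<cdot>\<^sub>m 1\<^sub>m n)"
  then have rc: "r < n" "c < n" by auto
  have "(row_blocks n b \<alpha> * col_blocks n b \<beta>) $$ (r, c) =
      (\<Sum>s = 0..<n * Suc b. (if s mod n = r then \<alpha> (s div n) else 0) * (if s mod n = c then \<beta> (s div n) else 0))"
    using rc by (simp add: row_blocks_def col_blocks_def scalar_prod_def del: mult_Suc_right)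
  also have "\<dots> = (\<Sum>s\<in>{s \<in> {0..<n * Suc b}. s mod n = r}. if r = c then \<alpha> (s div n) * \<beta> (s div n) else 0)"
    by (rule sum.mono_neutral_cong_right) auto
  also have "\<dots> = (\<Sum>j\<le>b. if r = c then \<alpha> j * \<beta> j else 0)"
  \<comment> \<open>Block j contains exactly one index with residue r, namely j n + r.\<close>
  proof (rule sum.reindex_bij_witness[of _ "\<lambda>j. j * n + r" "\<lambda>s. s div n"])
    fix s assume s: "s \<in> {s \<in> {0..<n * Suc b}. s mod n = r}"
    then show "s div n * n + r = s" using div_mult_mod_eq[of s n] by auto
    from s have "s div n < Suc b" by (intro less_mult_imp_div_less) (simp add: mult.commute)
    then show "s div n \<in> {..b}" by simp
    show "(if r = c then \<alpha> (s div n) * \<beta> (s div n) else 0) = (if r = c then \<alpha> (s div n) * \<beta> (s div n) else 0)" ..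
  next
    fix j assume "j \<in> {..b}"
    then have "j * n + r < Suc j * n" "Suc j * n \<le> Suc b * n" using rc by auto
    then have "j * n + r < n * Suc b" by (metis less_le_trans mult.commute)
    then show "j * n + r \<in> {s \<in> {0..<n * Suc b}. s mod n = r}" using rc by simp
    show "(j * n + r) div n = j" using rc by simp
  qed
  also have "\<dots> = ((\<Sum>j\<le>b. \<alpha> j * \<beta> j) \<cdot>\<^sub>m 1\<^sub>m n) $$ (r, c)" using rc by simp
  finally show "(row_blocks n b \<alpha> * col_blocks n b \<beta>) $$ (r, c) = ((\<Sum>j\<le>b. \<alpha> j * \<beta> j) \<cdot>\<^sub>m 1\<^sub>m n) $$ (r, c)" .
qed (simp_all add: row_blocks_def col_blocks_def)

text \<open>The value is a linear form in \<alpha>, so polynomial functions of the matrix become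
  polynomials in \<alpha>. Since L is only additive and homogeneous on matrices, the blocks are
  filled in one at a time.\<close>

lemma functional_row_blocks:
  assumes L: "L \<in> functional (Hom_space (K_pow (n * Suc b)) (K_pow n))"
  shows "L (mmap (row_blocks n b \<alpha>)) = (\<Sum>j\<le>b. \<alpha> j * L (mmap (row_blocks n b (\<lambda>i. if i = j then 1 else 0))))"
proof -
  have "L (mmap (row_blocks n b (\<lambda>i. if i < k then \<alpha> i else 0))) =
      (\<Sum>j<k. \<alpha> j * L (mmap (row_blocks n b (\<lambda>i. if i = j then 1 else 0))))" for k
  proof (induction k)
    case 0
    have "row_blocks n b (\<lambda>i. if i < 0 then \<alpha> i else 0) = 0 \<cdot>\<^sub>m row_blocks n b \<alpha>"
      by (auto simp: row_blocks_def intro!: eq_matI)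
    then show ?case using functional_mmap_smult[OF L blocks_carrier(1), of 0] by simp
  next
    case (Suc k)
    have "row_blocks n b (\<lambda>i. if i < Suc k then \<alpha> i else 0) = row_blocks n b (\<lambda>i. if i < k then \<alpha> i else 0) +
        \<alpha> k \<cdot>\<^sub>m row_blocks n b (\<lambda>i. if i = k then 1 else 0)"
      by (rule eq_matI) (auto simp: row_blocks_def less_Suc_eq)
    then show ?case
      by (simp only: functional_mmap_add[OF L blocks_carrier(1) smult_carrier_mat[OF blocks_carrier(1)]]
        functional_mmap_smult[OF L blocks_carrier(1)] Suc sum.lessThan_Suc)
  qed
  from this[of "Suc b"] have "L (mmap (row_blocks n b (\<lambda>i. if i < Suc b then \<alpha> i else 0))) =
      (\<Sum>j\<le>b. \<alpha> j * L (mmap (row_blocks n b (\<lambda>i. if i = j then 1 else 0))))"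
    by (simp only: lessThan_Suc_atMost)
  moreover have "row_blocks n b (\<lambda>i. if i < Suc b then \<alpha> i else 0) = row_blocks n b \<alpha>"
  proof (rule eq_matI)
    fix r s assume "r < dim_row (row_blocks n b \<alpha>)" "s < dim_col (row_blocks n b \<alpha>)"
    then have "r < n" "s < n * Suc b" by (auto simp: row_blocks_def)
    moreover from this have "s div n < Suc b" by (intro less_mult_imp_div_less) (simp add: mult.commute)
    ultimately show "row_blocks n b (\<lambda>i. if i < Suc b then \<alpha> i else 0) $$ (r, s) = row_blocks n b \<alpha> $$ (r, s)"
      by (simp add: row_blocks_def del: mult_Suc_right)
  qed (simp_all add: row_blocks_def)
  ultimately show ?thesis by simp
qed

text \<open>For k <= m the projection that forgets coordinates, for k >= m the inclusion that pads
  with zeros; \<open>P_inf_lift\<close> uses both.\<close>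

definition trunc :: "nat \<Rightarrow> nat \<Rightarrow> 'k::field mat" where
  "trunc k m = mat k m (\<lambda>(i, j). if i = j then 1 else 0)"

lemma trunc_carrier [simp]: "trunc k m \<in> carrier_mat k m"
  by (simp add: trunc_def)

lemma trunc_mult_vec:
  assumes "v \<in> carrier_vec m" "i < k"
  shows "(trunc k m *\<^sub>v v) $ i = (if i < m then v $ i else 0)"
proof -
  have "(trunc k m *\<^sub>v v) $ i = (\<Sum>j = 0..<m. (if i = j then 1 else 0) * v $ j)"
    using assms by (simp add: trunc_def scalar_prod_def)
  also have "\<dots> = (\<Sum>j = 0..<m. if j = i then v $ i else 0)" by (intro sum.cong) auto
  also have "\<dots> = (if i < m then v $ i else 0)" by simp
  finally show ?thesis .
qed

lemma K_proj_eq_mmap: "n \<le> m \<Longrightarrow> K_proj m n = mmap (trunc n m)"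
  unfolding K_proj_def mmap_def
  by (auto simp: fun_eq_iff vec_first_def trunc_mult_vec carrier_matD[OF trunc_carrier] intro!: eq_vecI
      simp del: index_mult_mat_vec)

text \<open>Passing through K^l loses none of the first k coordinates, whatever m is.\<close>

lemma trunc_mult: "k \<le> l \<Longrightarrow> trunc k l * trunc l m = (trunc k m :: 'k::field mat)"
proof (rule eq_matI)
  fix i j assume "k \<le> l" "i < dim_row (trunc k m :: 'k mat)" "j < dim_col (trunc k m :: 'k mat)"
  then have ij: "i < k" "j < m" "i < l" by (auto simp: trunc_def)
  have "(trunc k l * trunc l m :: 'k mat) $$ (i, j) = (trunc k l *\<^sub>v col (trunc l m) j) $ i"
    using ij by (simp add: trunc_def)
  also have "\<dots> = trunc k m $$ (i, j)"
    using ij by (subst trunc_mult_vec) (auto simp: trunc_def)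
  finally show "(trunc k l * trunc l m :: 'k mat) $$ (i, j) = trunc k m $$ (i, j)" .
qed (simp_all add: trunc_def)

lemma trunc_self: "trunc m m = 1\<^sub>m m"
  by (auto simp: trunc_def)

subsection \<open>The infinite general linear group\<close>

lemma invertible_mat_iff_det:
  fixes A :: "'k::field mat"
  assumes A: "A \<in> carrier_mat n n"
  shows "invertible_mat A \<longleftrightarrow> det A \<noteq> 0"
proof
  assume "invertible_mat A"
  then obtain B where AB: "A * B = 1\<^sub>m (dim_row A)" "B * A = 1\<^sub>m (dim_row B)"
    unfolding invertible_mat_def inverts_mat_def by auto
  have "dim_col (A * B) = n" "dim_col (B * A) = dim_row B" using AB A by simp_all
  then have "B \<in> carrier_mat n n" using A by auto
  then have "det A * det B = 1" using det_mult[OF A, of B] AB(1) A by simp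
  then show "det A \<noteq> 0" by auto
next
  assume "det A \<noteq> 0"
  from det_non_zero_imp_unit[OF A this, of undefined] obtain B where
    "B \<in> carrier_mat n n" "A * B = 1\<^sub>m n" "B * A = 1\<^sub>m n"
    by (auto simp: Units_def ring_mat_simps)
  then show "invertible_mat A" using A unfolding invertible_mat_def inverts_mat_def by auto
qed

lemma GL_iff_det:
  "g \<in> GL n \<longleftrightarrow> det (corner n g) \<noteq> 0 \<and> (\<forall>i j. n \<le> i \<or> n \<le> j \<longrightarrow> g i j = (if i = j then 1 else 0))"
  by (simp add: GL_def invertible_mat_iff_det[OF corner_carrier])

lemma GL_mono:
  assumes "g \<in> GL l" "l \<le> N"
  shows "g \<in> GL N"
proof -
  have "corner N g = four_block_mat (corner l g) (0\<^sub>m l (N - l)) (0\<^sub>m (N - l) l) (1\<^sub>m (N - l))"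
    using assms by (intro eq_matI) (auto simp: corner_def GL_iff_det)
  then have "det (corner N g) = det (corner l g) * det (1\<^sub>m (N - l))"
    by (simp add: det_four_block_mat_lower_left_zero[OF corner_carrier _ _ one_carrier_mat])
  then show ?thesis using assms by (auto simp: GL_iff_det)
qed

text \<open>For g and h in \<open>GL N\<close> this is the product of the infinite matrices; the
  explicit N keeps it a product of finite ones.\<close>

definition GL_mult :: "nat \<Rightarrow> (nat \<Rightarrow> nat \<Rightarrow> 'k::field) \<Rightarrow> (nat \<Rightarrow> nat \<Rightarrow> 'k) \<Rightarrow> nat \<Rightarrow> nat \<Rightarrow> 'k" where
  "GL_mult N g h i j =
    (if i < N \<and> j < N then (corner N g * corner N h) $$ (i, j) else if i = j then 1 else 0)"

lemma corner_GL_mult: "corner N (GL_mult N g h) = corner N g * corner N h"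
  by (rule eq_matI) (auto simp: corner_def GL_mult_def)

lemma GL_mult_in_GL: "g \<in> GL N \<Longrightarrow> h \<in> GL N \<Longrightarrow> GL_mult N g h \<in> GL N"
  by (auto simp: GL_iff_det corner_GL_mult det_mult[OF corner_carrier corner_carrier])
    (auto simp: GL_mult_def)

text \<open>Completes the surjection \<open>row_blocks n b \<alpha>\<close> to a square matrix by
  rows of the identity. With \<open>\<alpha> 0 = 1\<close> it is upper triangular with ones on the
  diagonal, hence invertible.\<close>

definition block_unipotent :: "nat \<Rightarrow> nat \<Rightarrow> (nat \<Rightarrow> 'k::field) \<Rightarrow> nat \<Rightarrow> nat \<Rightarrow> 'k" where
  "block_unipotent n b \<alpha> i j =
    (if i < n \<and> j < n * Suc b then row_blocks n b \<alpha> $$ (i, j) else if i = j then 1 else 0)"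

lemma block_unipotent_GL:
  assumes "\<alpha> 0 = 1"
  shows "block_unipotent n b \<alpha> \<in> GL (n * Suc b)"
proof -
  let ?g = "block_unipotent n b \<alpha>" and ?m = "n * Suc b"
  have "upper_triangular (corner ?m ?g)"
    unfolding upper_triangular_def
    by (auto simp: corner_def block_unipotent_def row_blocks_def simp del: mult_Suc_right)
  then have "det (corner ?m ?g) = prod_list (diag_mat (corner ?m ?g))"
    by (rule det_upper_triangular[OF _ corner_carrier])
  also have "diag_mat (corner ?m ?g) = map (\<lambda>_. 1) [0..<?m]"
    using assms by (auto simp: diag_mat_def corner_def block_unipotent_def row_blocks_def simp del: mult_Suc_right)
  also have "prod_list \<dots> = 1" by (simp only: map_replicate_const prod_list_replicate power_one)
  finally have "det (corner ?m ?g) \<noteq> 0" by simp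
  then show ?thesis unfolding GL_iff_det by (intro conjI) (assumption, auto simp: block_unipotent_def)
qed

lemma trunc_block_unipotent: "trunc n (n * Suc b) * corner (n * Suc b) (block_unipotent n b \<alpha>) = row_blocks n b \<alpha>"
proof (rule eq_matI)
  fix i j assume "i < dim_row (row_blocks n b \<alpha>)" "j < dim_col (row_blocks n b \<alpha>)"
  then have ij: "i < n" "j < n * Suc b" by (auto simp: row_blocks_def)
  then have im: "i < n * Suc b" by simp
  let ?G = "corner (n * Suc b) (block_unipotent n b \<alpha>)"
  have "(trunc n (n * Suc b) * ?G) $$ (i, j) = (trunc n (n * Suc b) *\<^sub>v col ?G j) $ i"
    using ij by (simp add: trunc_def corner_def del: mult_Suc_right)
  also have "\<dots> = row_blocks n b \<alpha> $$ (i, j)"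
    using ij im by (subst trunc_mult_vec)
      (auto simp: corner_def block_unipotent_def simp del: mult_Suc_right)
  finally show "(trunc n (n * Suc b) * ?G) $$ (i, j) = row_blocks n b \<alpha> $$ (i, j)" .
qed (simp_all add: trunc_def corner_def row_blocks_def)

section \<open>Geometry: the functor on matrices, density of the orbit, and surjectivity\<close>

subsection \<open>Polynomial functors on matrices\<close>

context polynomial_functor
begin

definition P_mat :: "'k mat \<Rightarrow> 'w \<Rightarrow> 'w" where
  "P_mat A = Mor (K_pow (dim_col A)) (K_pow (dim_row A)) (mmap A)"

abbreviation PK :: "nat \<Rightarrow> ('k, 'w) module" where
  "PK n \<equiv> Ob (K_pow n)"

lemma P_mat_eq: "A \<in> carrier_mat n m \<Longrightarrow> P_mat A = Mor (K_pow m) (K_pow n) (mmap A)"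
  by (auto simp: P_mat_def)

lemma P_mat_Hom: "A \<in> carrier_mat n m \<Longrightarrow> P_mat A \<in> Hom (PK m) (PK n)"
  by (simp add: P_mat_eq Mor_Hom K_pow_in_Vec mmap_Hom)

lemma P_mat_closed: "A \<in> carrier_mat n m \<Longrightarrow> x \<in> carrier (PK m) \<Longrightarrow> P_mat A x \<in> carrier (PK n)"
  using P_mat_Hom[of A n m] by (auto simp: Hom_iff)

lemma P_mat_mult:
  assumes "A \<in> carrier_mat n m" "B \<in> carrier_mat k n" "x \<in> carrier (PK m)"
  shows "P_mat B (P_mat A x) = P_mat (B * A) x"
  using assms mmap_compose[OF assms(1,2)]
  by (simp add: P_mat_eq[OF assms(1)] P_mat_eq[OF assms(2)] P_mat_eq[OF mult_carrier_mat[OF assms(2,1)]]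
    Mor_apply_compose K_pow_in_Vec mmap_Hom module_vec_simps)

lemma P_mat_one: "x \<in> carrier (PK n) \<Longrightarrow> P_mat (1\<^sub>m n) x = x"
  using Mor_id[OF K_pow_in_Vec, of n] by (simp add: P_mat_def mmap_one)

lemma PK_Vec: "PK n \<in> Vec"
  by (rule Ob_Vec[OF K_pow_in_Vec])

text \<open>Evaluation at x followed by l is a linear functional on Hom(P(K^m), P(K^n)), so the
  definition of a polynomial map applies to it. One d serves all m and n.\<close>

lemma degree_bound:
  "\<exists>d. \<forall>m n. \<forall>l\<in>functional (PK n). \<forall>x\<in>carrier (PK m).
    \<exists>f. poly_fun (Hom_space (K_pow m) (K_pow n)) d f \<and> (\<forall>A\<in>carrier_mat n m. l (P_mat A x) = f (mmap A))"
proof -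
  obtain d where d: "\<And>U V. U \<in> Vec \<Longrightarrow> V \<in> Vec \<Longrightarrow>
    poly_map d (Hom_space U V) (Hom_space (Ob U) (Ob V)) (Mor U V)"
    using bounded_degree by metis
  show ?thesis
  proof (intro exI[of _ d] allI ballI)
    fix m n l x assume l: "l \<in> functional (PK n)" and x: "x \<in> carrier (PK m)"
    note map = d[OF K_pow_in_Vec K_pow_in_Vec, of m n, unfolded poly_map_def, THEN conjunct2]
    obtain f where f: "poly_fun (Hom_space (K_pow m) (K_pow n)) d f"
      "\<forall>T\<in>carrier (Hom_space (K_pow m) (K_pow n)). l (Mor (K_pow m) (K_pow n) T x) = f T"
      using bspec[OF map functional_eval[OF x l]] by blast
    show "\<exists>f. poly_fun (Hom_space (K_pow m) (K_pow n)) d f \<and> (\<forall>A\<in>carrier_mat n m. l (P_mat A x) = f (mmap A))"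
      using f mmap_Hom by (intro exI[of _ f]) (auto simp: P_mat_eq Hom_space_def)
  qed
qed

lemma P_mat_row_blocks_polyfuns:
  assumes l: "l \<in> functional (PK n)" and x: "x \<in> carrier (PK (n * Suc b))"
    and \<alpha>: "\<And>j. (\<lambda>a. \<alpha> a j) \<in> polyfuns"
  shows "(\<lambda>a. l (P_mat (row_blocks n b (\<alpha> a)) x)) \<in> polyfuns"
proof -
  obtain d f where f: "poly_fun (Hom_space (K_pow (n * Suc b)) (K_pow n)) d f"
    "\<And>A. A \<in> carrier_mat n (n * Suc b) \<Longrightarrow> l (P_mat A x) = f (mmap A)"
    using degree_bound l x by metis
  have "(\<lambda>a. L (mmap (row_blocks n b (\<alpha> a)))) \<in> polyfuns"
    if L: "L \<in> functional (Hom_space (K_pow (n * Suc b)) (K_pow n))" for L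
    unfolding functional_row_blocks[OF L, of "\<alpha> _"]
    by (intro polyfuns_sum range_peval_mult range_peval_const \<alpha>)
  from poly_fun_family[where \<gamma> = "\<lambda>a. mmap (row_blocks n b (\<alpha> a))", OF f(1) this] show ?thesis
    by (simp only: f(2)[OF blocks_carrier(1)])
qed

text \<open>Allows a second group element to be applied to an orbit point found by density. The
  actions are compared in a component N' beyond the sizes of both matrices, where they are given by
  corners, and then projected to component n.\<close>

lemma gl_act_mult:
  assumes p: "p \<in> P_inf Ob Mor" and g: "g \<in> GL_inf" and h: "h \<in> GL_inf"
  shows "\<exists>k\<in>GL_inf. gl_act Mor k p = gl_act Mor h (gl_act Mor g p)"
proof -
  obtain l l' where "g \<in> GL l" "h \<in> GL l'" using g h by (auto simp: GL_inf_def)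
  then have gh: "g \<in> GL N" "h \<in> GL N" if "N \<ge> max l l'" for N using GL_mono that by auto
  define N where "N = max l l'"
  let ?k = "GL_mult N h g"
  have kN: "?k \<in> GL N" using gh[of N] GL_mult_in_GL by (simp add: N_def)
  then have k: "?k \<in> GL_inf" by (auto simp: GL_inf_def)
  note q = gl_act_in_P_inf[OF p g]
  have "gl_act Mor ?k p n = gl_act Mor h (gl_act Mor g p) n" for n
  proof -
    define N' where "N' = max N n"
    have N': "N \<le> N'" "n \<le> N'" by (auto simp: N'_def)
    \<comment> \<open>The product formed at size N is still the product at size N', because beyond N
      both factors agree with the identity.\<close>
    have corner: "corner N' ?k = corner N' h * corner N' g"
    proof (rule eq_matI)
      fix i j assume "i < dim_row (corner N' h * corner N' g)" "j < dim_col (corner N' h * corner N' g)"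
      then have ij: "i < N'" "j < N'" by (auto simp: corner_def)
      have g': "g i j = (if i = j then 1 else 0)" "h i j = (if i = j then 1 else 0)" if "N \<le> i \<or> N \<le> j" for i j
        using gh[of N] that by (auto simp: GL_def N_def)
      have *: "(corner N' h * corner N' g) $$ (i, j) = (\<Sum>s = 0..<N'. h i s * g s j)"
        using ij by (simp add: corner_def scalar_prod_def)
      show "corner N' ?k $$ (i, j) = (corner N' h * corner N' g) $$ (i, j)"
      proof (cases "i < N \<and> j < N")
        case True
        have "(\<Sum>s = 0..<N'. h i s * g s j) = (\<Sum>s = 0..<N. h i s * g s j)"
          using N' True by (intro sum.mono_neutral_right) (auto simp: g')
        then show ?thesis using True ij unfolding *
          by (simp add: corner_def GL_mult_def scalar_prod_def)
      next
        case False
        then consider "N \<le> i" | "i < N" "N \<le> j" by linarith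
        then have "(\<Sum>s = 0..<N'. h i s * g s j) = (if i = j then 1 else 0)"
        proof cases
          case 1
          then have "(\<Sum>s = 0..<N'. h i s * g s j) = (\<Sum>s = 0..<N'. if s = i then g i j else 0)"
            by (intro sum.cong) (auto simp: g')
          then show ?thesis using ij 1 by (simp add: g')
        next
          case 2
          then have "(\<Sum>s = 0..<N'. h i s * g s j) = (\<Sum>s = 0..<N'. if s = j then h i j else 0)"
            by (intro sum.cong) (auto simp: g')
          then show ?thesis using ij 2 by (simp add: g')
        qed
        then show ?thesis using False ij unfolding * by (auto simp: corner_def GL_mult_def)
      qed
    qed (simp_all add: corner_def)
    have pN: "p N' \<in> carrier (PK N')" using p by (simp add: P_inf_def)
    have "gl_act Mor ?k p N' = P_mat (corner N' ?k) (p N')"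
      using gl_act_component[OF p kN N'(1)] by (simp add: P_mat_eq[OF corner_carrier] mat_map_eq_mmap)
    also have "\<dots> = P_mat (corner N' h) (P_mat (corner N' g) (p N'))"
      using P_mat_mult[OF corner_carrier corner_carrier pN] corner by simp
    also have "P_mat (corner N' g) (p N') = gl_act Mor g p N'"
      using gl_act_component[OF p gh(1)[of N] N'(1)]
      by (simp add: P_mat_eq[OF corner_carrier] mat_map_eq_mmap N_def)
    also have "P_mat (corner N' h) \<dots> = gl_act Mor h (gl_act Mor g p) N'"
      using gl_act_component[OF q gh(2)[of N] N'(1)]
      by (simp add: P_mat_eq[OF corner_carrier] mat_map_eq_mmap N_def)
    finally have "gl_act Mor ?k p N' = gl_act Mor h (gl_act Mor g p) N'" .
    then show ?thesis
      using P_inf_proj[OF gl_act_in_P_inf[OF p k] N'(2)] P_inf_proj[OF gl_act_in_P_inf[OF q h] N'(2)] by simp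
  qed
  then show ?thesis using k by blast
qed

lemma gl_act_block_unipotent:
  assumes q: "q \<in> P_inf Ob Mor" and "\<alpha> 0 = 1"
  shows "gl_act Mor (block_unipotent n b \<alpha>) q n = P_mat (row_blocks n b \<alpha>) (q (n * Suc b))"
proof -
  have nm: "n \<le> n * Suc b" by simp
  have qm: "q (n * Suc b) \<in> carrier (PK (n * Suc b))" using q by (simp add: P_inf_def)
  have "gl_act Mor (block_unipotent n b \<alpha>) q n =
      P_mat (trunc n (n * Suc b)) (P_mat (corner (n * Suc b) (block_unipotent n b \<alpha>)) (q (n * Suc b)))"
    using gl_act_eq[OF q block_unipotent_GL[of \<alpha> n b] order_refl nm] assms(2)
    by (simp only: P_mat_eq[OF corner_carrier] P_mat_eq[OF trunc_carrier] mat_map_eq_mmap K_proj_eq_mmap[OF nm])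
  then show ?thesis
    by (simp only: P_mat_mult[OF corner_carrier trunc_carrier qm] trunc_block_unipotent)
qed

text \<open>x is padded with zeros for k >= m and projected for k < m. Hence nonempty open sets of
  P(K^m) have nonempty preimages in the inverse limit, as the density argument requires.\<close>

lemma P_inf_lift:
  assumes x: "x \<in> carrier (PK m)"
  shows "\<exists>q\<in>P_inf Ob Mor. q m = x"
proof (intro bexI[of _ "\<lambda>k. P_mat (trunc k m) x"])
  show "P_mat (trunc m m) x = x" using x by (simp add: trunc_self P_mat_one)
  have "Mor (K_pow (Suc k)) (K_pow k) (K_proj (Suc k) k) (P_mat (trunc (Suc k) m) x) = P_mat (trunc k m) x" for k
    using P_mat_mult[OF trunc_carrier trunc_carrier x, of k "Suc k"]
    by (simp add: K_proj_eq_mmap trunc_mult P_mat_eq[OF trunc_carrier])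
  then show "(\<lambda>k. P_mat (trunc k m) x) \<in> P_inf Ob Mor"
    using P_mat_closed[OF trunc_carrier x] by (simp add: P_inf_def)
qed

lemma dense_orbit_meets:
  assumes p: "p \<in> P_inf Ob Mor"
    and dense: "P_inf_topology Ob Mor closure_of GL_orbit Mor p = topspace (P_inf_topology Ob Mor)"
    and f: "poly_fun (PK m) d f" and x: "x \<in> carrier (PK m)" "f x \<noteq> 0"
  shows "\<exists>g\<in>GL_inf. f (gl_act Mor g p m) \<noteq> 0"
proof -
  obtain q where q: "q \<in> P_inf Ob Mor" "q m = x" using P_inf_lift[OF x(1)] by blast
  let ?T = "product_topology (\<lambda>n. zariski (PK n)) UNIV"
  have top: "P_inf Ob Mor \<subseteq> topspace ?T"
    by (auto simp: topspace_zariski P_inf_def)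
  define U where "U = {y \<in> carrier (PK m). f y \<noteq> 0}"
  have "openin (zariski (PK m)) U"
    unfolding openin_zariski zariski_open_def U_def using f by (intro exI[of _ "{f}"]) auto
  then have "openin ?T {y \<in> topspace ?T. y m \<in> U}"
    by (intro openin_continuous_map_preimage[OF continuous_map_product_projection]) auto
  define W where "W = {y \<in> topspace ?T. y m \<in> U} \<inter> P_inf Ob Mor"
  have "openin (P_inf_topology Ob Mor) W"
    unfolding P_inf_topology_def openin_subtopology W_def
    using \<open>openin ?T {y \<in> topspace ?T. y m \<in> U}\<close> by blast
  moreover have "q \<in> W" using q x top by (auto simp: U_def W_def)
  moreover have "q \<in> P_inf_topology Ob Mor closure_of GL_orbit Mor p"
    unfolding dense using q top by (auto simp: P_inf_topology_def)
  ultimately obtain y where y: "y \<in> GL_orbit Mor p" "y \<in> W" unfolding in_closure_of by metis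
  then obtain g where "g \<in> GL_inf" "y = gl_act Mor g p" by (auto simp: GL_orbit_def)
  then show ?thesis using y(2) by (auto simp: W_def U_def)
qed

end

context pure_polynomial_functor
begin

text \<open>The zero map factors through K^0, where P vanishes by purity, and P of the second factor
  is linear.\<close>

lemma P_mat_zero:
  assumes l: "l \<in> functional (PK n)" and x: "x \<in> carrier (PK n)"
  shows "l (P_mat (0\<^sub>m n n) x) = 0"
proof -
  have "carrier (K_pow 0 :: ('a, 'a vec) module) = {\<zero>\<^bsub>K_pow 0\<^esub>}"
    by (auto simp: module_vec_simps)
  then have "carrier (PK 0) = {\<zero>\<^bsub>PK 0\<^esub>}" by (rule pure[OF K_pow_in_Vec])
  then have "P_mat (0\<^sub>m 0 n) x = \<zero>\<^bsub>PK 0\<^esub>" using P_mat_closed[of "0\<^sub>m 0 n" 0 n x] x by auto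
  moreover have "0\<^sub>m n n = 0\<^sub>m n 0 * (0\<^sub>m 0 n :: 'a mat)" by (rule eq_matI) (auto simp: scalar_prod_def)
  ultimately have "P_mat (0\<^sub>m n n) x = P_mat (0\<^sub>m n 0) \<zero>\<^bsub>PK 0\<^esub>"
    using P_mat_mult[of "0\<^sub>m 0 n" 0 n "0\<^sub>m n 0" n x] x by simp
  then show ?thesis
    using functional_zero[OF PK_Vec functional_comp_Hom[OF P_mat_Hom[of "0\<^sub>m n 0" n 0] l]] by simp
qed

end

locale pure_polynomial_functor_alg_closed_char_0 = pure_polynomial_functor Ob Mor
  for Ob :: "('k::{alg_closed_field, field_char_0}, 'k vec) module \<Rightarrow> ('k, 'w) module"
    and Mor :: "('k, 'k vec) module \<Rightarrow> ('k, 'k vec) module \<Rightarrow> ('k vec \<Rightarrow> 'k vec) \<Rightarrow> ('w \<Rightarrow> 'w)"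
begin

text \<open>u -> l(P(u id) r) is a polynomial g of degree at most d, with g(0) = 0 by purity and
  g(1) = l r. The weights turn each power u^i with i >= 1 into a, so the sum is a g(1). They are
  chosen before a, so a point built from them serves all a at once.\<close>

lemma polarisation:
  "\<exists>(d :: nat) w \<alpha> \<beta>. \<forall>n a. \<forall>l\<in>functional (PK n). \<forall>r\<in>carrier (PK n).
    (\<Sum>s\<in>{..d} \<times> {..d}. w s * l (P_mat ((\<alpha> s + \<beta> s * a) \<cdot>\<^sub>m 1\<^sub>m n) r)) = a * l r"
proof -
  obtain d where d: "\<forall>m n. \<forall>l\<in>functional (PK n). \<forall>x\<in>carrier (PK m).
    \<exists>f. poly_fun (Hom_space (K_pow m) (K_pow n)) d f \<and> (\<forall>A\<in>carrier_mat n m. l (P_mat A x) = f (mmap A))"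
    using degree_bound by (elim exE)
  obtain w \<alpha> \<beta> :: "nat \<times> nat \<Rightarrow> 'k" where
    w: "\<forall>i\<in>{1..d}. \<forall>a. (\<Sum>s\<in>{..d} \<times> {..d}. w s * (\<alpha> s + \<beta> s * a) ^ i) = a"
    using polarisation_weights[of d, where ?'k = 'k] by (elim exE)
  have "(\<Sum>s\<in>{..d} \<times> {..d}. w s * l (P_mat ((\<alpha> s + \<beta> s * a) \<cdot>\<^sub>m 1\<^sub>m n) r)) = a * l r"
    if l: "l \<in> functional (PK n)" and r: "r \<in> carrier (PK n)" for n l r a
  proof -
    obtain f where f: "poly_fun (Hom_space (K_pow n) (K_pow n)) d f"
      "\<And>A. A \<in> carrier_mat n n \<Longrightarrow> l (P_mat A r) = f (mmap A)" using d l r by blast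
    have "\<exists>c. \<forall>u. L (mmap (u \<cdot>\<^sub>m 1\<^sub>m n)) = u * c" if "L \<in> functional (Hom_space (K_pow n) (K_pow n))" for L
      using functional_mmap_smult[OF that one_carrier_mat] by blast
    from poly_fun_line[where \<gamma> = "\<lambda>u. mmap (u \<cdot>\<^sub>m 1\<^sub>m n)", OF f(1) this] obtain g where
      deg: "degree g \<le> d" and "\<And>u. f (mmap (u \<cdot>\<^sub>m 1\<^sub>m n)) = poly g u" by blast
    then have g': "l (P_mat (u \<cdot>\<^sub>m 1\<^sub>m n) r) = poly g u" for u
      using f(2)[of "u \<cdot>\<^sub>m 1\<^sub>m n"] by simp
    have g: "l (P_mat (u \<cdot>\<^sub>m 1\<^sub>m n) r) = (\<Sum>i\<le>d. coeff g i * u ^ i)" for u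
      using arg_cong[OF poly_as_sum_of_monoms'[OF deg], of "\<lambda>p. poly p u"]
      by (simp add: g' poly_sum poly_monom)
    have "0 \<cdot>\<^sub>m 1\<^sub>m n = (0\<^sub>m n n :: 'k mat)" by (rule eq_matI) auto
    then have g0: "coeff g 0 = 0"
      using g'[of 0] P_mat_zero[OF l r] by (simp add: poly_0_coeff_0)
    have "1 \<cdot>\<^sub>m 1\<^sub>m n = (1\<^sub>m n :: 'k mat)" by (rule eq_matI) auto
    then have g1: "(\<Sum>i\<le>d. coeff g i) = l r"
      using g[of 1] P_mat_one[OF r] by simp
    have "(\<Sum>s\<in>{..d} \<times> {..d}. w s * l (P_mat ((\<alpha> s + \<beta> s * a) \<cdot>\<^sub>m 1\<^sub>m n) r)) =
        (\<Sum>s\<in>{..d} \<times> {..d}. \<Sum>i\<le>d. coeff g i * (w s * (\<alpha> s + \<beta> s * a) ^ i))"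
      unfolding g sum_distrib_left by (intro sum.cong refl) (simp add: mult_ac)
    also have "\<dots> = (\<Sum>i\<le>d. coeff g i * (\<Sum>s\<in>{..d} \<times> {..d}. w s * (\<alpha> s + \<beta> s * a) ^ i))"
      by (subst sum.swap) (simp add: sum_distrib_left)
    also have "\<dots> = (\<Sum>i\<le>d. coeff g i * a)"
    proof (intro sum.cong refl)
      fix i assume "i \<in> {..d}"
      then show "coeff g i * (\<Sum>s\<in>{..d} \<times> {..d}. w s * (\<alpha> s + \<beta> s * a) ^ i) = coeff g i * a"
        using w g0 by (cases "i = 0") auto
    qed
    also have "\<dots> = a * l r" unfolding g1[symmetric] sum_distrib_left by (simp add: mult.commute)
    finally show ?thesis .
  qed
  then show ?thesis by (intro exI[of _ d] exI[of _ w] exI[of _ \<alpha>] exI[of _ \<beta>]) blast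
qed

lemma orbit_projection_surjective:
  assumes p: "p \<in> P_inf Ob Mor"
    and dense: "P_inf_topology Ob Mor closure_of GL_orbit Mor p = topspace (P_inf_topology Ob Mor)"
    and n: "n \<ge> 1" and q: "q \<in> carrier (PK n)"
  shows "\<exists>g\<in>GL_inf. gl_act Mor g p n = q"
proof -
  obtain b e \<mu> where "dual_basis (PK n) b e \<mu>" using dual_basis_exists[OF PK_Vec] by blast
  note e = dual_basisD(1)[OF this] and \<mu> = dual_basisD(2)[OF this] and \<mu>e = dual_basisD(3)[OF this]
    and sep = dual_basisD(5)[OF this]
  define m where "m = n * Suc b"
  obtain M E \<nu> where "dual_basis (PK m) M E \<nu>" using dual_basis_exists[OF PK_Vec] by blast
  note E = dual_basisD(1)[OF this] and \<nu> = dual_basisD(2)[OF this] and \<nu>E = dual_basisD(3)[OF this]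
    and expand = dual_basisD(4)[OF this]
  obtain d :: nat and w \<alpha> \<beta> where pol: "\<forall>n a. \<forall>l\<in>functional (PK n). \<forall>r\<in>carrier (PK n).
      (\<Sum>s\<in>{..d} \<times> {..d}. w s * l (P_mat ((\<alpha> s + \<beta> s * a) \<cdot>\<^sub>m 1\<^sub>m n) r)) = a * l r"
    using polarisation by (elim exE)
  \<comment> \<open>The block coefficients are 1, a_0, ..., a_(b-1); the leading 1 is the one that
    \<open>block_unipotent_GL\<close> asks for.\<close>
  define R where "R a = row_blocks n b (case_nat 1 a)" for a :: "nat \<Rightarrow> 'k"
  have R: "R a \<in> carrier_mat n m" for a by (simp add: R_def m_def del: mult_Suc_right)
  define C where "C \<gamma> = col_blocks n b \<gamma>" for \<gamma> :: "nat \<Rightarrow> 'k"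
  have C: "C \<gamma> \<in> carrier_mat m n" for \<gamma> by (simp add: C_def m_def del: mult_Suc_right)
  have RC: "P_mat (R a) (P_mat (C \<gamma>) x) = P_mat ((\<gamma> 0 + (\<Sum>i<b. a i * \<gamma> (Suc i))) \<cdot>\<^sub>m 1\<^sub>m n) x"
    if "x \<in> carrier (PK n)" for a \<gamma> x
  proof -
    have "R a * C \<gamma> = (\<gamma> 0 + (\<Sum>i<b. a i * \<gamma> (Suc i))) \<cdot>\<^sub>m 1\<^sub>m n"
      unfolding R_def C_def blocks_mult[OF n] by (simp add: sum.atMost_shift)
    then show ?thesis using P_mat_mult[OF C R that] by simp
  qed
  \<comment> \<open>Chosen so that \<open>R a * C (\<gamma> j s)\<close> is (\<alpha> s + \<beta> s
    a_j) id, the multiples of id that polarisation sums up.\<close>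
  define \<gamma> where "\<gamma> j s i = (if i = 0 then \<alpha> s else if i = Suc j then \<beta> s else 0)" for j s i
  define v where "v k = P_mat (C (\<gamma> (fst k) (snd k))) (e (fst k))" for k
  have v: "v k \<in> carrier (PK m)" if "k \<in> {..<b} \<times> ({..d} \<times> {..d})" for k
    using that P_mat_closed[OF C e] by (auto simp: v_def)
  \<comment> \<open>By polarisation applied to each \<open>e j\<close>, the map P(R a) sends x0 to
    the sum of the a_j e_j.\<close>
  obtain x0 where x0: "x0 \<in> carrier (PK m)"
    "\<And>l. l \<in> functional (PK m) \<Longrightarrow> l x0 = (\<Sum>k\<in>{..<b} \<times> ({..d} \<times> {..d}). w (snd k) * l (v k))"
    using linear_combination_exists[OF PK_Vec, of "{..<b} \<times> ({..d} \<times> {..d})" v m "\<lambda>k. w (snd k)"] v by auto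
  \<comment> \<open>q placed in block 0, on which \<open>R a\<close> is the identity, so that P(R a)
    sends q' back to q for every a.\<close>
  define q' where "q' = P_mat (C (\<lambda>i. if i = 0 then 1 else 0)) q"
  have q': "q' \<in> carrier (PK m)" unfolding q'_def by (rule P_mat_closed[OF C q])
  define p0 where "p0 = q' \<oplus>\<^bsub>PK m\<^esub> x0"
  have p0: "p0 \<in> carrier (PK m)" unfolding p0_def by (rule Vec_closed(2)[OF PK_Vec q' x0(1)])
  have F: "(\<lambda>x. l (P_mat (R a) x)) \<in> functional (PK m)" if "l \<in> functional (PK n)" for l a
    by (rule functional_comp_Hom[OF P_mat_Hom[OF R] that])
  have p0_image: "l (P_mat (R a) p0) = l q + (\<Sum>j<b. a j * l (e j))" if l: "l \<in> functional (PK n)" for l a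
  proof -
    have "P_mat (R a) q' = q"
    proof -
      have "1 \<cdot>\<^sub>m 1\<^sub>m n = (1\<^sub>m n :: 'k mat)" by (rule eq_matI) auto
      then show ?thesis unfolding q'_def RC[OF q] by (simp add: P_mat_one[OF q])
    qed
    moreover have "l (P_mat (R a) x0) = (\<Sum>j<b. a j * l (e j))"
    proof -
      have "l (P_mat (R a) x0) = (\<Sum>k\<in>{..<b} \<times> ({..d} \<times> {..d}). w (snd k) * l (P_mat (R a) (v k)))"
        by (rule x0(2)[OF F[OF l]])
      also have "\<dots> = (\<Sum>j<b. \<Sum>s\<in>{..d} \<times> {..d}. w s * l (P_mat (R a) (v (j, s))))"
        unfolding sum.cartesian_product by (intro sum.cong refl) auto
      also have "\<dots> = (\<Sum>j<b. \<Sum>s\<in>{..d} \<times> {..d}. w s * l (P_mat ((\<alpha> s + \<beta> s * a j) \<cdot>\<^sub>m 1\<^sub>m n) (e j)))"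
      proof (intro sum.cong refl)
        fix j s assume "j \<in> {..<b}"
        then have j: "j < b" by simp
        have "(\<Sum>i<b. a i * \<gamma> j s (Suc i)) = (\<Sum>i<b. if i = j then \<beta> s * a j else 0)"
          by (intro sum.cong) (auto simp: \<gamma>_def)
        then have "\<gamma> j s 0 + (\<Sum>i<b. a i * \<gamma> j s (Suc i)) = \<alpha> s + \<beta> s * a j"
          using j by (simp add: \<gamma>_def)
        then show "w s * l (P_mat (R a) (v (j, s))) = w s * l (P_mat ((\<alpha> s + \<beta> s * a j) \<cdot>\<^sub>m 1\<^sub>m n) (e j))"
          using RC[OF e[OF j], of a "\<gamma> j s"] by (simp add: v_def)
      qed
      also have "\<dots> = (\<Sum>j<b. a j * l (e j))" using pol l e by (intro sum.cong refl) simp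
      finally show ?thesis .
    qed
    ultimately show ?thesis using functional_add[OF F[OF l] q' x0(1)] by (simp add: p0_def)
  qed
  \<comment> \<open>For x = p0 + sum_j c_j E_j, coordinate i of P(R a) x - q is a_i plus the sum of
    the c_j \<mu>_i(P(R a) E_j). Solving for a_i produces the minus sign.\<close>
  have "\<exists>f. i < b \<longrightarrow> j < M \<longrightarrow> (\<forall>a. - \<mu> i (P_mat (R a) (E j)) = peval (\<lambda>x. x) a f)" for i j
  proof (cases "i < b \<and> j < M")
    case True
    have "(\<lambda>a. \<mu> i (P_mat (R a) (E j))) \<in> polyfuns" unfolding R_def
    proof (rule P_mat_row_blocks_polyfuns)
      show "\<mu> i \<in> functional (PK n)" "E j \<in> carrier (PK (n * Suc b))" using True \<mu> E by (auto simp: m_def)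
      show "(\<lambda>a. case_nat 1 a k) \<in> polyfuns" for k
        by (cases k) (simp_all add: polyfuns_var range_peval_const)
    qed
    then have "(\<lambda>a. - 1 * \<mu> i (P_mat (R a) (E j))) \<in> polyfuns"
      by (rule range_peval_mult[OF range_peval_const])
    then obtain f where "(\<lambda>a. - 1 * \<mu> i (P_mat (R a) (E j))) = (\<lambda>a. peval (\<lambda>x. x) a f)" by blast
    then have "- \<mu> i (P_mat (R a) (E j)) = peval (\<lambda>x. x) a f" for a using fun_cong[of _ _ a] by fastforce
    then show ?thesis by blast
  qed auto
  then obtain f where f: "\<And>i j a. i < b \<Longrightarrow> j < M \<Longrightarrow> - \<mu> i (P_mat (R a) (E j)) = peval (\<lambda>x. x) a (f i j)"
    by metis
  obtain H c0 where c0: "peval (\<lambda>x. x) c0 H \<noteq> 0" and H: "\<And>c. peval (\<lambda>x. x) c H \<noteq> 0 \<Longrightarrow>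
    \<exists>a. \<forall>i<b. a i = (\<Sum>j<M. c j * peval (\<lambda>x. x) a (f i j))"
    using generic_system_solvable[where b = b and M = M and f = f] by metis
  \<comment> \<open>The expression H may contain variables of index at least M; these are frozen at
    their values in c0, so that the nonzero value of H at c0 is attained on P(K^m).\<close>
  define c where "c j x = (if j < M then \<nu> j x + - \<nu> j p0 else c0 j)" for j x
  have "\<exists>d. poly_fun (PK m) d (c j)" for j
  proof (cases "j < M")
    case True
    then have "poly_fun (PK m) 1 (\<lambda>x. \<nu> j x + - \<nu> j p0)"
      by (intro poly_fun.add poly_fun_functional \<nu> poly_fun.const)
    moreover have "c j = (\<lambda>x. \<nu> j x + - \<nu> j p0)" using True by (intro ext) (simp add: c_def)
    ultimately show ?thesis by metis
  next
    case False
    then have "c j = (\<lambda>_. c0 j)" by (intro ext) (simp add: c_def)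
    then show ?thesis using poly_fun.const by metis
  qed
  from poly_fun_peval[where c = c and e = H, OF this] obtain d' where d': "poly_fun (PK m) d' (\<lambda>x. peval (\<lambda>x. x) (\<lambda>j. c j x) H)"
    by blast
  \<comment> \<open>p0 + x1 has coordinates c0 relative to p0, so it is a point of P(K^m) where H
    does not vanish.\<close>
  obtain x1 where x1: "x1 \<in> carrier (PK m)" "\<And>l. l \<in> functional (PK m) \<Longrightarrow> l x1 = (\<Sum>j<M. c0 j * l (E j))"
    using linear_combination_exists[OF PK_Vec, of "{..<M}" E m c0] E by auto
  have "c j (p0 \<oplus>\<^bsub>PK m\<^esub> x1) = c0 j" for j
  proof (cases "j < M")
    case True
    have "\<nu> j x1 = (\<Sum>i<M. if i = j then c0 j else 0)"
      unfolding x1(2)[OF \<nu>[OF True]] by (intro sum.cong) (auto simp: \<nu>E True)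
    then show ?thesis using True functional_add[OF \<nu>[OF True] p0 x1(1)] by (simp add: c_def)
  qed (simp add: c_def)
  then have "peval (\<lambda>x. x) (\<lambda>j. c j (p0 \<oplus>\<^bsub>PK m\<^esub> x1)) H \<noteq> 0" using c0 by simp
  from dense_orbit_meets[OF p dense d' Vec_closed(2)[OF PK_Vec p0 x1(1)] this]
  obtain g where g: "g \<in> GL_inf" "peval (\<lambda>x. x) (\<lambda>j. c j (gl_act Mor g p m)) H \<noteq> 0" by blast
  define y where "y = gl_act Mor g p"
  have yP: "y \<in> P_inf Ob Mor" unfolding y_def by (rule gl_act_in_P_inf[OF p g(1)])
  then have ym: "y m \<in> carrier (PK m)" by (simp add: P_inf_def)
  obtain a where a: "\<And>i. i < b \<Longrightarrow> a i = (\<Sum>j<M. c j (y m) * peval (\<lambda>x. x) a (f i j))"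
    using H[OF g(2)] unfolding y_def by blast
  have "P_mat (R a) (y m) = q"
  proof (rule sep)
    show "P_mat (R a) (y m) \<in> carrier (PK n)" by (rule P_mat_closed[OF R ym])
    show "q \<in> carrier (PK n)" by (rule q)
    fix i assume i: "i < b"
    note Fi = F[OF \<mu>[OF i], of a]
    have "a i = (\<Sum>j<M. (\<nu> j (y m) - \<nu> j p0) * - \<mu> i (P_mat (R a) (E j)))"
      unfolding a[OF i] by (intro sum.cong refl) (simp add: c_def f[OF i, symmetric])
    also have "\<dots> = \<mu> i (P_mat (R a) p0) - \<mu> i (P_mat (R a) (y m))"
      unfolding expand[OF Fi ym] expand[OF Fi p0] sum_subtractf[symmetric]
      by (intro sum.cong refl) (simp add: algebra_simps)
    also have "\<mu> i (P_mat (R a) p0) = \<mu> i q + (\<Sum>j<b. if j = i then a i else 0)"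
      unfolding p0_image[OF \<mu>[OF i]] by (intro arg_cong2[of _ _ _ _ "(+)"] sum.cong refl) (auto simp: \<mu>e i)
    also have "\<dots> = \<mu> i q + a i" using i by simp
    finally show "\<mu> i (P_mat (R a) (y m)) = \<mu> i q" by simp
  qed
  then have "gl_act Mor (block_unipotent n b (case_nat 1 a)) y n = q"
    using gl_act_block_unipotent[OF yP, of "case_nat 1 a" n b] by (simp add: R_def m_def)
  moreover have "block_unipotent n b (case_nat 1 a) \<in> GL_inf"
    using block_unipotent_GL[of "case_nat 1 a" n b] by (auto simp: GL_inf_def)
  ultimately show ?thesis using gl_act_mult[OF p g(1)] unfolding y_def by metis
qed

end

theorem corollary2p6p3:
  fixes Ob :: "('k::{alg_closed_field, field_char_0}, 'k vec) module \<Rightarrow> ('k, 'w) module"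
    and Mor :: "('k, 'k vec) module \<Rightarrow> ('k, 'k vec) module \<Rightarrow> ('k vec \<Rightarrow> 'k vec) \<Rightarrow> ('w \<Rightarrow> 'w)"
    and p :: "nat \<Rightarrow> 'w"
  assumes "pure_polynomial_functor Ob Mor"
    and "p \<in> P_inf Ob Mor"
    and "P_inf_topology Ob Mor closure_of GL_orbit Mor p = topspace (P_inf_topology Ob Mor)"
  shows "\<forall>n\<ge>1. (\<lambda>q. q n) ` GL_orbit Mor p = carrier (Ob (K_pow n))"
proof -
  interpret pure_polynomial_functor_alg_closed_char_0 Ob Mor
    by (simp add: pure_polynomial_functor_alg_closed_char_0_def assms(1))
  show ?thesis
  proof (intro allI impI equalityI subsetI)
    fix n :: nat and x
    assume "x \<in> (\<lambda>q. q n) ` GL_orbit Mor p"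
    then show "x \<in> carrier (Ob (K_pow n))"
      using gl_act_in_P_inf[OF assms(2)] by (auto simp: GL_orbit_def P_inf_def)
  next
    fix n :: nat and x
    assume "n \<ge> 1" "x \<in> carrier (Ob (K_pow n))"
    from orbit_projection_surjective[OF assms(2,3) this]
    show "x \<in> (\<lambda>q. q n) ` GL_orbit Mor p" by (auto simp: GL_orbit_def)
  qed
qed

end
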